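(* Let $A\in\mathbb{R}^{n\times n}$, $C_i\in\mathbb{R}^{m_i\times n}$ for $i=1,\ldots,N$, and $C=\mathrm{col}(C_1,\ldots,C_N)$. For each $i$ let $\nu_i=\dim\ker(\mathcal{O}_i)$, where $\mathcal{O}_i=\mathrm{col}(C_i,C_iA,\ldots,C_iA^{n-1})$, and let $U_i\in\mathbb{R}^{n\times\nu_i}$ be a matrix whose columns form an orthonormal basis of $\ker(\mathcal{O}_i)$. Let $\nu=\sum_{i=1}^N\nu_i$ and $U=\mathrm{block\ diag}\{U_1,\ldots,U_N\}\in\mathbb{R}^{Nn\times\nu}$. Let $\mathcal{G}_{\sigma(t)}$ be an undirected switching graph on the nodes $\{1,\ldots,N\}$ with Laplacian $\mathcal{L}_{\sigma(t)}$, and let $Q\in\mathbb{R}^{\nu\times\nu}$ be any symmetric positive definite matrix. Assume that the pair $(C,A)$ is observable and that $\mathcal{G}_{\sigma(t)}$ is jointly connected. Then the linear switched system $$\dot\eta(t)=-QU^T\bigl(\mathcal{L}_{\sigma(t)}\otimes I_n\bigr)U\eta(t),\qquad t\ge0,$$ with state $\eta(t)\in\mathbb{R}^\nu$, is exponentially stable.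
   Context: **Notation.** $\mathrm{col}(X_1,\ldots,X_N)=[X_1^T\ \cdots\ X_N^T]^T$; $\otimes$ is the Kronecker product. Blocks of zero size are allowed. Solutions are continuous and satisfy the differential equation except at switching instants. **Exponential stability.** A linear time-varying system $\dot z(t)=A(t)z(t)$, $t\ge 0$, is exponentially stable if there exist $c,\lambda>0$ such that $\|z(t)\|\le ce^{-\lambda(t-t^* )}\|z(t^* )\|$ for all $t\ge t^*\ge0$ and all solutions. **Switching signal and graph.** $\sigma:[0,\infty)\to\mathcal{P}=\{1,\ldots,n_0\}$ is a piecewise constant switching signal: there is a sequence $\{t_j:j=0,1,2,\ldots\}$ (the switching instants) with $t_0=0$ and $t_{j+1}-t_j\ge\tau$ for all $j$, for some $\tau>0$ (the dwell time), such that $\sigma$ is constant on each $[t_j,t_{j+1})$. There are $n_0$ undirected graphs $\mathcal{G}_p=(\mathcal{V},\mathcal{E}_p)$, $p\in\mathcal{P}$, on $\mathcal{V}=\{1,\ldots,N\}$, each with a weighted adjacency matrix $\mathcal{A}_p=[a_{ij}]\in\mathbb{R}^{N\times N}$ that is symmetric, with $a_{ii}=0$ and, for $i\ne j$, $a_{ij}>0$ if $(j,i)\in\mathcal{E}_p$ and $a_{ij}=0$ otherwise. The Laplacian $\mathcal{L}_p=[l_{ij}]$ is given by $l_{ii}=\sum_{j=1}^Na_{ij}$ and $l_{ij}=-a_{ij}$ for $i\ne j$. The switching graph is $\mathcal{G}_{\sigma(t)}=(\mathcal{V},\mathcal{E}_{\sigma(t)})$, with Laplacian $\mathcal{L}_{\sigma(t)}$.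 **Jointly connected.** There exists a subsequence $\{t_{j_k}:k=0,1,2,\ldots\}$ of the switching instants with $t_{j_0}=0$ and $\tau\le t_{j_{k+1}}-t_{j_k}\le T_c$ for all $k$, for some $T_c>0$, such that for every $k$ the union graph $\bigcup_{t_j\in[t_{j_k},t_{j_{k+1}})}\mathcal{G}_{\sigma(t_j)}$ (node set $\mathcal{V}$, edge set the union of the edge sets) is connected. *)

theory Defs
  imports
    Complex_Main
    "Jordan_Normal_Form.Matrix_Kernel"
    "Jordan_Normal_Form.DL_Rank"
    "Graph_Theory.Pair_Digraph"
    "Graph_Theory.Digraph_Component"
begin

text \<open>
  Node \<open>i\<close> of the mathematical text (\<open>1 \<le> i \<le> N\<close>) is represented by \<open>i - 1\<close>, so that the node set
  \<open>{..<N}\<close> coincides with the index range of \<open>N \<times> N\<close> matrices.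
\<close>

section \<open>Matrices\<close>

text \<open>\<open>col(X\<^sub>1, \<dots>, X\<^sub>k)\<close>; the explicit column count \<open>n\<close> matters only for the empty list.\<close>

definition stack_rows :: "nat \<Rightarrow> 'a::zero mat list \<Rightarrow> 'a mat" where
  "stack_rows n Xs = foldr (@\<^sub>r) Xs (0\<^sub>m 0 n)"

definition kronecker :: "'a::semiring_1 mat \<Rightarrow> 'a mat \<Rightarrow> 'a mat" where
  "kronecker X Y = mat (dim_row X * dim_row Y) (dim_col X * dim_col Y)
     (\<lambda>(i, j). X $$ (i div dim_row Y, j div dim_col Y) * Y $$ (i mod dim_row Y, j mod dim_col Y))"

definition observability_mat :: "nat \<Rightarrow> 'a::semiring_1 mat \<Rightarrow> 'a mat \<Rightarrow> 'a mat" where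
  "observability_mat n C A = stack_rows n (map (\<lambda>k. C * A ^\<^sub>m k) [0..<n])"

text \<open>Kalman rank condition; \<open>vec_space.rank\<close> takes the number of rows as its first argument.\<close>

definition observable :: "nat \<Rightarrow> real mat \<Rightarrow> real mat \<Rightarrow> bool" where
  "observable n C A \<longleftrightarrow>
     vec_space.rank (dim_row (observability_mat n C A)) (observability_mat n C A) = n"

definition orthonormal_cols :: "real mat \<Rightarrow> bool" where
  "orthonormal_cols U \<longleftrightarrow> (\<forall>j < dim_col U. \<forall>k < dim_col U.
     scalar_prod (col U j) (col U k) = (if j = k then 1 else 0))"

definition cols_orthonormal_basis_of_kernel :: "real mat \<Rightarrow> real mat \<Rightarrow> bool" where
  "cols_orthonormal_basis_of_kernel M U \<longleftrightarrow>
     orthonormal_cols U \<and> kernel.basis (dim_col M) M (set (cols U))"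

definition symmetric_positive_definite :: "nat \<Rightarrow> real mat \<Rightarrow> bool" where
  "symmetric_positive_definite n Q \<longleftrightarrow>
     Q \<in> carrier_mat n n \<and> transpose_mat Q = Q \<and>
     (\<forall>x \<in> carrier_vec n. x \<noteq> 0\<^sub>v n \<longrightarrow> scalar_prod x (Q *\<^sub>v x) > 0)"

section \<open>Weighted undirected graphs\<close>

text \<open>An undirected graph is a digraph whose arc relation is symmetric.\<close>

definition undirected_graph_on :: "nat \<Rightarrow> nat pair_pre_digraph \<Rightarrow> bool" where
  "undirected_graph_on N G \<longleftrightarrow> pair_sym_digraph G \<and> pverts G = {..<N}"

definition weighted_adjacency :: "nat \<Rightarrow> nat pair_pre_digraph \<Rightarrow> real mat \<Rightarrow> bool" where
  "weighted_adjacency N G W \<longleftrightarrow>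
     W \<in> carrier_mat N N \<and> transpose_mat W = W \<and>
     (\<forall>i < N. W $$ (i, i) = 0) \<and>
     (\<forall>i < N. \<forall>j < N. i \<noteq> j \<longrightarrow>
        ((j, i) \<in> parcs G \<longrightarrow> W $$ (i, j) > 0) \<and> ((j, i) \<notin> parcs G \<longrightarrow> W $$ (i, j) = 0))"

definition laplacian :: "real mat \<Rightarrow> real mat" where
  "laplacian W = mat (dim_row W) (dim_row W)
     (\<lambda>(i, j). if i = j then (\<Sum>k < dim_row W. W $$ (i, k)) else - W $$ (i, j))"

section \<open>Switching\<close>

definition switching_signal :: "nat \<Rightarrow> real \<Rightarrow> (nat \<Rightarrow> real) \<Rightarrow> (real \<Rightarrow> nat) \<Rightarrow> bool" where
  "switching_signal n0 \<tau> ts \<sigma> \<longleftrightarrow>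
     \<tau> > 0 \<and> ts 0 = 0 \<and> (\<forall>j. ts (Suc j) - ts j \<ge> \<tau>) \<and>
     (\<forall>t \<ge> 0. \<sigma> t \<in> {1..n0}) \<and>
     (\<forall>j. \<forall>t \<in> {ts j..<ts (Suc j)}. \<sigma> t = \<sigma> (ts j))"

text \<open>
  The qualified \<open>Digraph_Component.connected\<close> is graph connectedness, as opposed to the
  topological constant of the same name.
\<close>

definition jointly_connected ::
  "nat \<Rightarrow> real \<Rightarrow> (nat \<Rightarrow> real) \<Rightarrow> (real \<Rightarrow> nat) \<Rightarrow> (nat \<Rightarrow> nat pair_pre_digraph) \<Rightarrow> bool" where
  "jointly_connected N \<tau> ts \<sigma> G \<longleftrightarrow>
     (\<exists>Tc > 0. \<exists>J :: nat \<Rightarrow> nat. strict_mono J \<and> ts (J 0) = 0 \<and>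
        (\<forall>k. \<tau> \<le> ts (J (Suc k)) - ts (J k) \<and> ts (J (Suc k)) - ts (J k) \<le> Tc \<and>
           Digraph_Component.connected (with_proj
             \<lparr>pverts = {..<N},
              parcs = (\<Union>j \<in> {j. ts j \<in> {ts (J k)..<ts (J (Suc k))}}. parcs (G (\<sigma> (ts j))))\<rparr>)))"

section \<open>Linear time-varying systems\<close>

definition vec_norm2 :: "real vec \<Rightarrow> real" where
  "vec_norm2 v = sqrt (scalar_prod v v)"

text \<open>
  \<open>z\<close> solves \<open>z' = M(t) z\<close> on \<open>[0, \<infinity>)\<close> with state dimension \<open>d\<close>: it is continuous and the equation
  holds except at the instants in \<open>S\<close>. Since vectors of run-time dimension carry no topology,
  continuity and the derivative are taken componentwise.
\<close>

definition ltv_solution :: "nat \<Rightarrow> (real \<Rightarrow> real mat) \<Rightarrow> real set \<Rightarrow> (real \<Rightarrow> real vec) \<Rightarrow> bool" where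
  "ltv_solution d M S z \<longleftrightarrow>
     (\<forall>t \<ge> 0. z t \<in> carrier_vec d) \<and>
     (\<forall>i < d. continuous_on {0..} (\<lambda>t. vec_index (z t) i)) \<and>
     (\<forall>t \<in> {0..} - S. \<forall>i < d.
        ((\<lambda>s. vec_index (z s) i) has_real_derivative vec_index (M t *\<^sub>v z t) i) (at t within {0..}))"

definition exponentially_stable :: "nat \<Rightarrow> (real \<Rightarrow> real mat) \<Rightarrow> real set \<Rightarrow> bool" where
  "exponentially_stable d M S \<longleftrightarrow>
     (\<exists>c > 0. \<exists>r > 0. \<forall>z. ltv_solution d M S z \<longrightarrow>
        (\<forall>t0 \<ge> 0. \<forall>t \<ge> t0. vec_norm2 (z t) \<le> c * exp (- r * (t - t0)) * vec_norm2 (z t0)))"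

end

theory Submission
  imports Defs
begin

text \<open>
  Write \<open>M\<^sub>p = U\<^sup>T (\<L>\<^sub>p \<otimes> I) U\<close>. The system \<open>\<eta>' = - Q M\<^sub>\<sigma> \<eta>\<close> is a switched gradient flow: for the
  metric \<open>P = Q\<^sup>-\<^sup>1\<close> it descends the quadratic form of the positive semidefinite matrix that is
  active, and the energy \<open>V = \<eta>\<^sup>T P \<eta>\<close> satisfies \<open>V' = - 2 \<eta>\<^sup>T M\<^sub>\<sigma> \<eta> \<le> 0\<close> between
  switching instants. A single \<open>M\<^sub>p\<close> need not be
  definite, so the decay has to be gained over a whole window of the joint connectivity hypothesis.

  Let \<open>\<delta>\<close> be the drop of \<open>V\<close> over such a window, which starts at \<open>a\<close>. The state moves
  little when \<open>\<delta>\<close> is small: \<open>|M x|\<^sup>2 \<le> K x\<^sup>T M x\<close> for semidefinite \<open>M\<close>, so the squared speed is bounded by the rate of dissipation and \<open>|\<eta>(t) - \<eta>(a)|\<^sup>2 \<le> const \<cdot> \<delta>\<close> throughout the window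
  (\<open>displacement_le_energy_drop\<close>). Moreover each mode of the window is active for at
  least the dwell time, and during that time it dissipates about \<open>\<eta>(a)\<^sup>T M\<^sub>p \<eta>(a)\<close>, because \<open>\<eta>\<close> has
  hardly moved; hence \<open>\<eta>(a)\<^sup>T M\<^sub>p \<eta>(a) \<le> const \<cdot> \<delta>\<close> for each of these modes
  (\<open>dissipation_le_energy_drop\<close>). If the forms of the modes of the window have no common zero
  except the origin, their sum is coercive, so that \<open>V(a) \<le> const \<cdot> \<delta>\<close>. This is a contraction of
  \<open>V\<close> over the window, with a factor which is uniform because there are only finitely many sets of
  modes (\<open>energy_contracts_on_window\<close>). Since windows have bounded length, exponential decay
  follows (\<open>exponentially_stable_if_jointly_definite\<close>).

  It remains to see that the common zeros are trivial. If \<open>\<eta>\<^sup>T M\<^sub>p \<eta> = 0\<close>, then the blocks \<open>U\<^sub>i \<eta>\<^sub>i\<close> and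
  \<open>U\<^sub>j \<eta>\<^sub>j\<close> agree whenever \<open>p\<close> has an edge between \<open>i\<close> and \<open>j\<close>
  (\<open>kronecker_laplacian_form_zero_imp_blocks_eq\<close>). As the union graph of the window is connected, all
  blocks equal one vector, which lies in the unobservable subspace of every \<open>(C\<^sub>i, A)\<close>, hence in that
  of \<open>(C, A)\<close>, and so vanishes. Finally \<open>U\<close> is injective, since its blocks have orthonormal columns.
\<close>

section \<open>Quadratic forms\<close>

definition symmetric_psd :: "nat \<Rightarrow> real mat \<Rightarrow> bool" where
  "symmetric_psd d M \<longleftrightarrow> M \<in> carrier_mat d d \<and> transpose_mat M = M \<and> (\<forall>x \<in> carrier_vec d. 0 \<le> x \<bullet> (M *\<^sub>v x))"

lemma psdD:
  assumes "symmetric_psd d M"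
  shows "M \<in> carrier_mat d d" "transpose_mat M = M" "\<And>x. x \<in> carrier_vec d \<Longrightarrow> 0 \<le> x \<bullet> (M *\<^sub>v x)"
  using assms by (auto simp: symmetric_psd_def)

lemma spd_imp_psd: "symmetric_positive_definite d M \<Longrightarrow> symmetric_psd d M"
  unfolding symmetric_positive_definite_def symmetric_psd_def
  by (metis less_eq_real_def mult_mat_vec_carrier scalar_prod_left_zero)

text \<open>
  Solutions are differentiable in each component only, and the double sum is the form of \<open>x\<^sup>T M y\<close> to
  which the rules for derivatives of sums and products apply.
\<close>

lemma bilinear_form_sum:
  fixes M :: "real mat"
  assumes "M \<in> carrier_mat d d" "y \<in> carrier_vec d"
  shows "x \<bullet> (M *\<^sub>v y) = (\<Sum>i<d. \<Sum>j<d. x $ i * (M $$ (i,j) * y $ j))"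
  using assms by (simp add: scalar_prod_def atLeast0LessThan sum_distrib_left row_def)

lemma bilinear_form_symmetric:
  fixes M :: "real mat"
  assumes "M \<in> carrier_mat d d" "transpose_mat M = M" "x \<in> carrier_vec d" "y \<in> carrier_vec d"
  shows "x \<bullet> (M *\<^sub>v y) = y \<bullet> (M *\<^sub>v x)"
proof -
  have s: "M $$ (i,j) = M $$ (j,i)" if "i < d" "j < d" for i j
    using that assms(1,2) by (metis carrier_matD index_transpose_mat(1))
  have "x \<bullet> (M *\<^sub>v y) = (\<Sum>j<d. \<Sum>i<d. x $ i * (M $$ (i,j) * y $ j))"
    unfolding bilinear_form_sum[OF assms(1,4)] by (rule sum.swap)
  also have "\<dots> = y \<bullet> (M *\<^sub>v x)"
    unfolding bilinear_form_sum[OF assms(1,3)]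
    by (intro sum.cong refl) (use s in \<open>simp add: mult.left_commute mult.commute\<close>)
  finally show ?thesis .
qed

lemma quadratic_form_add_smult:
  fixes M :: "real mat"
  assumes M: "M \<in> carrier_mat d d" "transpose_mat M = M" and x: "x \<in> carrier_vec d" and y: "y \<in> carrier_vec d"
  shows "(x + t \<cdot>\<^sub>v y) \<bullet> (M *\<^sub>v (x + t \<cdot>\<^sub>v y)) =
           x \<bullet> (M *\<^sub>v x) + 2 * t * (y \<bullet> (M *\<^sub>v x)) + t\<^sup>2 * (y \<bullet> (M *\<^sub>v y))"
proof -
  have c: "t \<cdot>\<^sub>v y \<in> carrier_vec d" "M *\<^sub>v x \<in> carrier_vec d" "M *\<^sub>v y \<in> carrier_vec d"
    using M x y by auto
  have "M *\<^sub>v (x + t \<cdot>\<^sub>v y) = M *\<^sub>v x + t \<cdot>\<^sub>v (M *\<^sub>v y)"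
    using M x y c by (simp add: mult_add_distrib_mat_vec mult_mat_vec)
  then show ?thesis
    using x y c bilinear_form_symmetric[OF M x y]
    by (simp add: add_scalar_prod_distrib[of _ d] scalar_prod_add_distrib[of _ d] power2_eq_square algebra_simps)
qed

lemma self_scalar_prod_nonneg [simp]: "0 \<le> (x :: real vec) \<bullet> x"
  by (simp add: scalar_prod_def sum_nonneg)

lemma quadratic_form_bounded:
  fixes M :: "real mat"
  assumes M: "M \<in> carrier_mat d d"
  shows "\<exists>K>0. \<forall>x\<in>carrier_vec d. x \<bullet> (M *\<^sub>v x) \<le> K * (x \<bullet> x)"
proof (intro exI conjI ballI)
  let ?S = "\<Sum>i<d. \<Sum>j<d. \<bar>M $$ (i,j)\<bar>"
  show "0 < ?S + 1" by (simp add: add_nonneg_pos sum_nonneg)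
  fix x :: "real vec" assume x: "x \<in> carrier_vec d"
  have sq: "(x $ i)\<^sup>2 \<le> x \<bullet> x" if "i < d" for i
    using that x by (auto simp: scalar_prod_def power2_eq_square intro: member_le_sum)
  have "x $ i * (M $$ (i,j) * x $ j) \<le> \<bar>M $$ (i,j)\<bar> * (x \<bullet> x)" if "i < d" "j < d" for i j
  proof -
    have "2 * \<bar>x $ i * x $ j\<bar> \<le> (x $ i)\<^sup>2 + (x $ j)\<^sup>2"
      using sum_squares_bound[of "\<bar>x $ i\<bar>" "\<bar>x $ j\<bar>"] by (simp add: abs_mult)
    then have "\<bar>x $ i * x $ j\<bar> \<le> x \<bullet> x" using sq[of i] sq[of j] that by linarith
    then have "\<bar>M $$ (i,j)\<bar> * \<bar>x $ i * x $ j\<bar> \<le> \<bar>M $$ (i,j)\<bar> * (x \<bullet> x)"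
      by (rule mult_left_mono) simp
    moreover have "x $ i * (M $$ (i,j) * x $ j) \<le> \<bar>M $$ (i,j)\<bar> * \<bar>x $ i * x $ j\<bar>"
      by (metis abs_ge_self abs_mult mult.left_commute)
    ultimately show ?thesis by linarith
  qed
  then have "x \<bullet> (M *\<^sub>v x) \<le> ?S * (x \<bullet> x)"
    unfolding bilinear_form_sum[OF M x] sum_distrib_right by (intro sum_mono) auto
  then show "x \<bullet> (M *\<^sub>v x) \<le> (?S + 1) * (x \<bullet> x)"
    by (simp add: distrib_right add_increasing2)
qed

lemma mat_vec_norm_bounded:
  fixes M :: "real mat"
  assumes M: "M \<in> carrier_mat d d"
  shows "\<exists>K>0. \<forall>x\<in>carrier_vec d. (M *\<^sub>v x) \<bullet> (M *\<^sub>v x) \<le> K * (x \<bullet> x)"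
proof -
  have "(M *\<^sub>v x) \<bullet> (M *\<^sub>v x) = x \<bullet> ((transpose_mat M * M) *\<^sub>v x)" if "x \<in> carrier_vec d" for x
    using that M transpose_vec_mult_scalar[OF M that, of "M *\<^sub>v x"]
    by (simp add: comm_scalar_prod[of x d])
  then show ?thesis using quadratic_form_bounded[of "transpose_mat M * M" d] M by auto
qed

text \<open>
  Evaluating the form at \<open>x - M x / K\<close>, where \<open>K\<close> bounds the form of \<open>M\<close>, gives a nonnegative number
  which is at most \<open>x\<^sup>T M x - |M x|\<^sup>2 / K\<close>. The point is that the speed of a gradient flow is
  controlled by its dissipation, even in directions where \<open>M\<close> degenerates.
\<close>

lemma psd_norm_le_form:
  assumes "symmetric_psd d M"
  shows "\<exists>K>0. \<forall>x\<in>carrier_vec d. (M *\<^sub>v x) \<bullet> (M *\<^sub>v x) \<le> K * (x \<bullet> (M *\<^sub>v x))"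
proof -
  note M = psdD[OF assms]
  obtain K where K: "K > 0" "\<And>x. x \<in> carrier_vec d \<Longrightarrow> x \<bullet> (M *\<^sub>v x) \<le> K * (x \<bullet> x)"
    using quadratic_form_bounded[OF M(1)] by auto
  have "(M *\<^sub>v x) \<bullet> (M *\<^sub>v x) \<le> K * (x \<bullet> (M *\<^sub>v x))" if x: "x \<in> carrier_vec d" for x
  proof -
    define y where "y = M *\<^sub>v x"
    have y: "y \<in> carrier_vec d" using M x by (simp add: y_def)
    define t where "t = - 1 / K"
    have "0 \<le> (x + t \<cdot>\<^sub>v y) \<bullet> (M *\<^sub>v (x + t \<cdot>\<^sub>v y))" using x y by (intro M(3)) auto
    also have "\<dots> = x \<bullet> y + 2 * t * (y \<bullet> y) + t\<^sup>2 * (y \<bullet> (M *\<^sub>v y))"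
      unfolding quadratic_form_add_smult[OF M(1,2) x y] by (simp add: y_def)
    also have "\<dots> \<le> x \<bullet> y + 2 * t * (y \<bullet> y) + t\<^sup>2 * (K * (y \<bullet> y))"
      using K(2)[OF y] by (simp add: mult_left_mono)
    also have "\<dots> = x \<bullet> y - (y \<bullet> y) / K"
      using K(1) by (simp add: t_def power2_eq_square field_simps)
    finally show ?thesis using K(1) by (simp add: y_def field_simps)
  qed
  then show ?thesis using K(1) by blast
qed

text \<open>
  The parallelogram law for \<open>x\<close> and \<open>x - y\<close>, with the nonnegative value at their sum dropped.
\<close>

lemma psd_form_diff_le:
  assumes "symmetric_psd d M" and x: "x \<in> carrier_vec d" and y: "y \<in> carrier_vec d"
  shows "y \<bullet> (M *\<^sub>v y) \<le> 2 * (x \<bullet> (M *\<^sub>v x)) + 2 * ((x - y) \<bullet> (M *\<^sub>v (x - y)))"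
proof -
  note M = psdD[OF assms(1)]
  have d: "x - y \<in> carrier_vec d" using x y by simp
  have "x + (-1) \<cdot>\<^sub>v (x - y) = y" using x y by (intro eq_vecI) auto
  then have "y \<bullet> (M *\<^sub>v y) = x \<bullet> (M *\<^sub>v x) - 2 * ((x - y) \<bullet> (M *\<^sub>v x)) + ((x - y) \<bullet> (M *\<^sub>v (x - y)))"
    using quadratic_form_add_smult[OF M(1,2) x d, of "-1"] by simp
  moreover have "0 \<le> x \<bullet> (M *\<^sub>v x) + 2 * ((x - y) \<bullet> (M *\<^sub>v x)) + ((x - y) \<bullet> (M *\<^sub>v (x - y)))"
    using quadratic_form_add_smult[OF M(1,2) x d, of 1] M(3)[of "x + 1 \<cdot>\<^sub>v (x - y)"] x d by auto
  ultimately show ?thesis by linarith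
qed

lemma spd_inverse:
  assumes Q: "symmetric_positive_definite d Q"
  obtains P where "symmetric_positive_definite d P" "P * Q = 1\<^sub>m d" "Q * P = 1\<^sub>m d"
proof -
  have Qc: "Q \<in> carrier_mat d d" "transpose_mat Q = Q"
    and pos: "\<And>x. x \<in> carrier_vec d \<Longrightarrow> x \<noteq> 0\<^sub>v d \<Longrightarrow> x \<bullet> (Q *\<^sub>v x) > 0"
    using Q by (auto simp: symmetric_positive_definite_def)
  have "det Q \<noteq> 0"
  proof
    assume "det Q = 0"
    then obtain v where "v \<in> carrier_vec d" "v \<noteq> 0\<^sub>v d" "Q *\<^sub>v v = 0\<^sub>v d"
      using det_0_iff_vec_prod_zero_field[OF Qc(1)] by blast
    then show False using pos[of v] by simp
  qed
  from det_non_zero_imp_unit[OF Qc(1) this, of "()"]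
  obtain P where P: "P \<in> carrier_mat d d" "P * Q = 1\<^sub>m d" "Q * P = 1\<^sub>m d"
    by (auto simp: Units_def ring_mat_def)
  have "transpose_mat P * Q = 1\<^sub>m d"
    using transpose_mult[OF Qc(1) P(1)] Qc P by simp
  then have "transpose_mat P = transpose_mat P * (Q * P)" using P by simp
  also have "\<dots> = (transpose_mat P * Q) * P" using P Qc by (simp add: assoc_mult_mat[of _ d d _ d _ d])
  also have "\<dots> = P" using \<open>transpose_mat P * Q = 1\<^sub>m d\<close> P by simp
  finally have sym: "transpose_mat P = P" .
  have "x \<bullet> (P *\<^sub>v x) > 0" if x: "x \<in> carrier_vec d" "x \<noteq> 0\<^sub>v d" for x
  proof -
    define y where "y = P *\<^sub>v x"
    have y: "y \<in> carrier_vec d" using P x by (simp add: y_def)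
    have Qy: "Q *\<^sub>v y = x" using P Qc x by (simp add: y_def flip: assoc_mult_mat_vec[of _ d d _ d])
    then have "y \<noteq> 0\<^sub>v d" using x Qc by auto
    then have "0 < y \<bullet> (Q *\<^sub>v y)" using pos y by blast
    then show ?thesis using Qy y x by (simp add: y_def comm_scalar_prod[of _ d])
  qed
  then show thesis using that P sym by (auto simp: symmetric_positive_definite_def)
qed

text \<open>
  Compactness of the unit sphere is replaced by the inverse \<open>P\<close> of \<open>M\<close>: the bound
  \<open>|P y|\<^sup>2 \<le> K y\<^sup>T P y\<close> for \<open>y = M x\<close> reads \<open>|x|\<^sup>2 \<le> K x\<^sup>T M x\<close>.
\<close>

lemma spd_coercive:
  assumes M: "symmetric_positive_definite d M"
  shows "\<exists>K>0. \<forall>x\<in>carrier_vec d. x \<bullet> x \<le> K * (x \<bullet> (M *\<^sub>v x))"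
proof -
  obtain P where P: "symmetric_positive_definite d P" "P * M = 1\<^sub>m d" "M * P = 1\<^sub>m d"
    using spd_inverse[OF M] by blast
  have Mc: "M \<in> carrier_mat d d" and Pc: "P \<in> carrier_mat d d"
    using M P by (auto simp: symmetric_positive_definite_def)
  obtain K where K: "K > 0" "\<And>x. x \<in> carrier_vec d \<Longrightarrow> (P *\<^sub>v x) \<bullet> (P *\<^sub>v x) \<le> K * (x \<bullet> (P *\<^sub>v x))"
    using psd_norm_le_form[OF spd_imp_psd[OF P(1)]] by auto
  have "x \<bullet> x \<le> K * (x \<bullet> (M *\<^sub>v x))" if x: "x \<in> carrier_vec d" for x
  proof -
    have Mx: "M *\<^sub>v x \<in> carrier_vec d" using Mc x by simp
    have "P *\<^sub>v (M *\<^sub>v x) = x" using P Pc Mc x by (simp flip: assoc_mult_mat_vec[of _ d d _ d])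
    then show ?thesis
      using K(2)[OF Mx] x Mx by (simp add: comm_scalar_prod[of _ d])
  qed
  then show ?thesis using K(1) by blast
qed

lemma gram_form:
  fixes B K :: "real mat"
  assumes B: "B \<in> carrier_mat r d" and K: "K \<in> carrier_mat r r" and x: "x \<in> carrier_vec d"
  shows "x \<bullet> ((transpose_mat B * K * B) *\<^sub>v x) = (B *\<^sub>v x) \<bullet> (K *\<^sub>v (B *\<^sub>v x))"
proof -
  have Bx: "B *\<^sub>v x \<in> carrier_vec r" using B x by simp
  have BtK: "transpose_mat B * K \<in> carrier_mat d r" using B K by simp
  have KBx: "K *\<^sub>v (B *\<^sub>v x) \<in> carrier_vec r" using K Bx by simp
  have "(transpose_mat B * K * B) *\<^sub>v x = (transpose_mat B * K) *\<^sub>v (B *\<^sub>v x)"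
    by (rule assoc_mult_mat_vec[OF BtK B x])
  also have "\<dots> = transpose_mat B *\<^sub>v (K *\<^sub>v (B *\<^sub>v x))"
    using B by (intro assoc_mult_mat_vec[OF _ K Bx]) simp
  finally have "(transpose_mat B * K * B) *\<^sub>v x = transpose_mat B *\<^sub>v (K *\<^sub>v (B *\<^sub>v x))" .
  moreover have "transpose_mat B *\<^sub>v (K *\<^sub>v (B *\<^sub>v x)) \<in> carrier_vec d"
    using B KBx by (intro mult_mat_vec_carrier[of _ d r]) simp_all
  ultimately show ?thesis
    using transpose_vec_mult_scalar[OF B x KBx] x Bx KBx
    by (metis comm_scalar_prod)
qed

text \<open>
  Passing from \<open>K\<close> to \<open>B\<^sup>T K B\<close> restricts the form of \<open>K\<close> to the vectors \<open>B x\<close>; this is how the dynamics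
  projected by \<open>U\<close> inherits the form of the Laplacian.
\<close>

lemma psd_gram:
  assumes K: "symmetric_psd r K" and B: "B \<in> carrier_mat r d"
  shows "symmetric_psd d (transpose_mat B * K * B)"
  unfolding symmetric_psd_def
proof (intro conjI ballI)
  note Kd = psdD[OF K]
  have BtK: "transpose_mat B * K \<in> carrier_mat d r" using B Kd by simp
  show "transpose_mat B * K * B \<in> carrier_mat d d" using BtK B by simp
  have "transpose_mat (transpose_mat B * K * B) = transpose_mat B * transpose_mat (transpose_mat B * K)"
    by (rule transpose_mult[OF BtK B])
  also have "transpose_mat (transpose_mat B * K) = K * B"
    using transpose_mult[of "transpose_mat B" d r K r] B Kd by simp
  also have "transpose_mat B * (K * B) = transpose_mat B * K * B"
    using B Kd(1) by (intro assoc_mult_mat[symmetric, of _ d r _ r _ d]) simp_all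
  finally show "transpose_mat (transpose_mat B * K * B) = transpose_mat B * K * B" .
  fix x :: "real vec" assume x: "x \<in> carrier_vec d"
  show "0 \<le> x \<bullet> ((transpose_mat B * K * B) *\<^sub>v x)"
    unfolding gram_form[OF B Kd(1) x] using B x by (intro Kd(3)) simp
qed

text \<open>
  The sum of the matrices is positive definite: a sum of nonnegative terms vanishes only if each
  term does.
\<close>

lemma joint_psd_coercive:
  assumes fin: "finite S" and symmetric_psd: "\<And>p. p \<in> S \<Longrightarrow> symmetric_psd d (M p)"
    and ker: "\<And>x. x \<in> carrier_vec d \<Longrightarrow> (\<And>p. p \<in> S \<Longrightarrow> x \<bullet> (M p *\<^sub>v x) = 0) \<Longrightarrow> x = 0\<^sub>v d"
  shows "\<exists>K>0. \<forall>x\<in>carrier_vec d. x \<bullet> x \<le> K * (\<Sum>p\<in>S. x \<bullet> (M p *\<^sub>v x))"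
proof -
  define B where "B = mat d d (\<lambda>(i,j). \<Sum>p\<in>S. M p $$ (i,j))"
  have B: "B \<in> carrier_mat d d" by (simp add: B_def)
  have form: "x \<bullet> (B *\<^sub>v x) = (\<Sum>p\<in>S. x \<bullet> (M p *\<^sub>v x))" if x: "x \<in> carrier_vec d" for x
  proof -
    have "x \<bullet> (B *\<^sub>v x) = (\<Sum>i<d. \<Sum>j<d. \<Sum>p\<in>S. x $ i * (M p $$ (i,j) * x $ j))"
      unfolding bilinear_form_sum[OF B x]
      by (intro sum.cong refl) (simp add: B_def sum_distrib_left sum_distrib_right)
    also have "\<dots> = (\<Sum>p\<in>S. \<Sum>i<d. \<Sum>j<d. x $ i * (M p $$ (i,j) * x $ j))"
      by (subst (2) sum.swap, subst sum.swap[of _ "{..<d}" S]) (rule refl)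
    finally show ?thesis using bilinear_form_sum[OF psdD(1)[OF symmetric_psd] x] by simp
  qed
  have sym: "M p $$ (i,j) = M p $$ (j,i)" if "i < d" "j < d" "p \<in> S" for i j p
    using psdD(1,2)[OF symmetric_psd[OF that(3)]] that by (metis carrier_matD index_transpose_mat(1))
  have "symmetric_positive_definite d B"
    unfolding symmetric_positive_definite_def
  proof (intro conjI ballI impI)
    show "transpose_mat B = B" using sym by (intro eq_matI) (auto simp: B_def intro!: sum.cong)
    fix x :: "real vec" assume x: "x \<in> carrier_vec d" and nz: "x \<noteq> 0\<^sub>v d"
    from nz ker[OF x] obtain p where "p \<in> S" "x \<bullet> (M p *\<^sub>v x) \<noteq> 0" by blast
    with psdD(3)[OF symmetric_psd x] fin show "x \<bullet> (B *\<^sub>v x) > 0"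
      unfolding form[OF x] by (intro sum_pos2[of S p]) (auto simp: less_le)
  qed (rule B)
  from spd_coercive[OF this] show ?thesis using form by auto
qed

lemma uniform_constant_finite_family:
  fixes f g :: "'a \<Rightarrow> 'b \<Rightarrow> real"
  assumes "finite A"
    and bound: "\<And>a. a \<in> A \<Longrightarrow> \<exists>K>0. \<forall>x\<in>X. f a x \<le> K * g a x"
    and nonneg: "\<And>a x. a \<in> A \<Longrightarrow> x \<in> X \<Longrightarrow> 0 \<le> g a x"
  shows "\<exists>K>0. \<forall>a\<in>A. \<forall>x\<in>X. f a x \<le> K * g a x"
proof -
  obtain k where k: "\<And>a. a \<in> A \<Longrightarrow> k a > 0" "\<And>a x. a \<in> A \<Longrightarrow> x \<in> X \<Longrightarrow> f a x \<le> k a * g a x"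
    using bound by metis
  show ?thesis
  proof (intro exI[of _ "1 + sum k A"] conjI ballI)
    show "0 < 1 + sum k A" using k(1) by (simp add: add_pos_nonneg sum_nonneg less_imp_le)
    fix a x assume ax: "a \<in> A" "x \<in> X"
    have "k a \<le> sum k A" using ax assms(1) k(1) by (intro member_le_sum) (auto intro: less_imp_le)
    then have "k a * g a x \<le> (1 + sum k A) * g a x" using nonneg[OF ax] by (intro mult_right_mono) auto
    then show "f a x \<le> (1 + sum k A) * g a x" using k(2)[OF ax] by linarith
  qed
qed

section \<open>Monotonicity between switching instants\<close>

locale dwell_time =
  fixes \<tau> :: real and ts :: "nat \<Rightarrow> real"
  assumes tau_pos: "\<tau> > 0" and ts_0: "ts 0 = 0" and dwell: "\<And>j. \<tau> \<le> ts (Suc j) - ts j"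
begin

lemma ts_strict_mono: "strict_mono ts"
proof -
  have "ts j < ts (Suc j)" for j using tau_pos dwell[of j] by linarith
  then show ?thesis by (simp add: strict_mono_Suc_iff)
qed

lemma ts_less_iff: "ts i < ts j \<longleftrightarrow> i < j" and ts_le_iff: "ts i \<le> ts j \<longleftrightarrow> i \<le> j"
  using ts_strict_mono by (simp_all add: strict_mono_less strict_mono_less_eq)

lemma ts_nonneg: "0 \<le> ts j"
  using ts_le_iff[of 0 j] ts_0 by simp

lemma ts_lower: "real j * \<tau> \<le> ts j"
proof (induction j)
  case (Suc j)
  then show ?case using dwell[of j] by (simp add: algebra_simps)
qed (simp add: ts_0)

lemma ts_unbounded: "\<exists>j. t \<le> ts j"
proof -
  obtain j where "t / \<tau> \<le> real j" using real_arch_simple by blast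
  then have "t \<le> real j * \<tau>" using tau_pos by (simp add: field_simps)
  then show ?thesis using ts_lower[of j] by (intro exI[of _ j]) linarith
qed

lemma no_switch_inside: "ts j < t \<Longrightarrow> t < ts (Suc j) \<Longrightarrow> t \<notin> range ts"
  using ts_less_iff by fastforce

text \<open>
  The derivative may fail to exist at switching instants. There are only finitely many of them
  between \<open>a\<close> and \<open>b\<close>, and continuity joins the pieces; the induction runs over the index of a
  switching instant beyond the point \<open>y\<close>.
\<close>

lemma nonincreasing_if_deriv_nonpos:
  assumes "0 \<le> a" "a \<le> b" and cont: "continuous_on {0..} f"
    and deriv: "\<And>t. a < t \<Longrightarrow> t < b \<Longrightarrow> t \<notin> range ts \<Longrightarrow>
            \<exists>D\<le>0. (f has_real_derivative D) (at t within {0..})"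
  shows "f b \<le> f a"
proof -
  have piece: "f y \<le> f x" if "a \<le> x" "x \<le> y" "y \<le> b" "\<And>t. x < t \<Longrightarrow> t < y \<Longrightarrow> t \<notin> range ts" for x y
  proof (rule DERIV_nonpos_imp_decreasing_open[OF \<open>x \<le> y\<close>])
    fix t assume t: "x < t" "t < y"
    with that have "a < t" "t < b" "t \<notin> range ts" by auto
    then obtain D where D: "D \<le> 0" "(f has_real_derivative D) (at t within {0..})"
      using deriv by blast
    have "(f has_real_derivative D) (at t within {0<..})"
      by (rule has_field_derivative_subset[OF D(2)]) auto
    moreover have "at t within {0<..} = at t"
      using t that(1) assms(1) by (intro at_within_open) auto
    ultimately have "DERIV f t :> D" by metis
    then show "\<exists>D. DERIV f t :> D \<and> D \<le> 0" using D(1) by blast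
  next
    show "continuous_on {x..y} f"
      using cont by (rule continuous_on_subset) (use that(1) assms(1) in auto)
  qed
  have "a \<le> y \<Longrightarrow> y \<le> b \<Longrightarrow> y \<le> ts j \<Longrightarrow> f y \<le> f a" for j y
  proof (induction j arbitrary: y)
    case 0
    then show ?case using assms(1) ts_0 by (cases "y = a") auto
  next
    case (Suc j)
    show ?case
    proof (cases "y \<le> ts j")
      case True
      then show ?thesis using Suc by blast
    next
      case False
      show ?thesis
      proof (cases "a \<le> ts j")
        case True
        have "f y \<le> f (ts j)"
          using False True Suc.prems by (intro piece no_switch_inside[of j]) auto
        also have "\<dots> \<le> f a" using Suc.IH[of "ts j"] True False Suc.prems by simp
        finally show ?thesis .
      next
        case False
        then show ?thesis
          using Suc.prems by (intro piece no_switch_inside[of j]) auto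
      qed
    qed
  qed
  then show ?thesis using ts_unbounded[of b] assms(2) by blast
qed

end

lemma has_derivative_bilinear_form:
  fixes z w :: "real \<Rightarrow> real vec" and P :: "real mat"
  assumes P: "P \<in> carrier_mat d d" and t: "t \<in> S"
    and z: "\<And>s. s \<in> S \<Longrightarrow> z s \<in> carrier_vec d" and w: "\<And>s. s \<in> S \<Longrightarrow> w s \<in> carrier_vec d"
    and dz: "dz \<in> carrier_vec d" "\<And>i. i < d \<Longrightarrow> ((\<lambda>s. z s $ i) has_real_derivative dz $ i) (at t within S)"
    and dw: "dw \<in> carrier_vec d" "\<And>i. i < d \<Longrightarrow> ((\<lambda>s. w s $ i) has_real_derivative dw $ i) (at t within S)"
  shows "((\<lambda>s. w s \<bullet> (P *\<^sub>v z s)) has_real_derivative (dw \<bullet> (P *\<^sub>v z t) + w t \<bullet> (P *\<^sub>v dz))) (at t within S)"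
proof -
  have "((\<lambda>s. \<Sum>i<d. \<Sum>j<d. w s $ i * (P $$ (i,j) * z s $ j)) has_real_derivative
     (\<Sum>i<d. \<Sum>j<d. dw $ i * (P $$ (i,j) * z t $ j) + P $$ (i,j) * dz $ j * w t $ i)) (at t within S)"
    by (intro DERIV_sum DERIV_mult DERIV_cmult dz dw) auto
  also have "(\<Sum>i<d. \<Sum>j<d. dw $ i * (P $$ (i,j) * z t $ j) + P $$ (i,j) * dz $ j * w t $ i)
       = dw \<bullet> (P *\<^sub>v z t) + w t \<bullet> (P *\<^sub>v dz)"
    unfolding bilinear_form_sum[OF P z[OF t]] bilinear_form_sum[OF P dz(1)]
    by (simp add: sum.distrib mult.commute)
  finally show ?thesis
    by (rule has_field_derivative_transform_within[where d = 1]) (simp_all add: t bilinear_form_sum[OF P z])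
qed

lemma continuous_on_bilinear_form:
  fixes z w :: "real \<Rightarrow> real vec" and P :: "real mat"
  assumes P: "P \<in> carrier_mat d d"
    and z: "\<And>s. s \<in> S \<Longrightarrow> z s \<in> carrier_vec d"
    and "\<And>i. i < d \<Longrightarrow> continuous_on S (\<lambda>s. z s $ i)"
    and "\<And>i. i < d \<Longrightarrow> continuous_on S (\<lambda>s. w s $ i)"
  shows "continuous_on S (\<lambda>s. w s \<bullet> (P *\<^sub>v z s))"
proof -
  have "continuous_on S (\<lambda>s. \<Sum>i<d. \<Sum>j<d. w s $ i * (P $$ (i,j) * z s $ j))"
    using assms by (intro continuous_intros) auto
  then show ?thesis
    by (subst continuous_on_cong[OF refl]) (auto simp: bilinear_form_sum[OF P z])
qed

section \<open>Exponential stability\<close>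

text \<open>
  The signal is constrained for nonnegative times only, so that even the dimensions of the
  matrices involved are unknown before time 0, and their products can be reassociated only from then
  on.
\<close>

lemma exponentially_stable_cong:
  assumes "\<And>t. 0 \<le> t \<Longrightarrow> A t = B t"
  shows "exponentially_stable d A S \<longleftrightarrow> exponentially_stable d B S"
proof -
  have "ltv_solution d A S z \<longleftrightarrow> ltv_solution d B S z" for z
    unfolding ltv_solution_def using assms by simp
  then show ?thesis unfolding exponentially_stable_def by simp
qed

text \<open>
  Between \<open>s\<close> and \<open>t\<close> there is room for \<open>\<lfloor>(t - s) / T\<rfloor> > (t - s) / T - 1\<close> contractions; the factor
  \<open>1 / \<rho>\<close> pays for rounding down.
\<close>

lemma exponential_decay_of_uniform_contraction:
  fixes V :: "real \<Rightarrow> real"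
  assumes T: "T > 0" and \<rho>: "0 < \<rho>" "\<rho> < 1"
    and mono: "\<And>s t. 0 \<le> s \<Longrightarrow> s \<le> t \<Longrightarrow> V t \<le> V s"
    and contr: "\<And>t. 0 \<le> t \<Longrightarrow> V (t + T) \<le> \<rho> * V t"
    and nonneg: "\<And>t. 0 \<le> t \<Longrightarrow> 0 \<le> V t"
    and t: "0 \<le> s" "s \<le> t"
  shows "V t \<le> (1 / \<rho>) * exp (ln \<rho> / T * (t - s)) * V s"
proof -
  have iter: "V (s + real m * T) \<le> \<rho> ^ m * V s" for m
  proof (induction m)
    case (Suc m)
    have "V (s + real (Suc m) * T) = V (s + real m * T + T)" by (simp add: algebra_simps)
    also have "\<dots> \<le> \<rho> * V (s + real m * T)" using t T by (intro contr) simp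
    also have "\<dots> \<le> \<rho> * (\<rho> ^ m * V s)" using Suc \<rho> by simp
    finally show ?case by (simp add: mult.assoc)
  qed simp
  define m where "m = nat \<lfloor>(t - s) / T\<rfloor>"
  have m: "real m \<le> (t - s) / T" "(t - s) / T < real m + 1"
    using t T by (simp_all add: m_def)
  have "s + real m * T \<le> t" using m T by (simp add: field_simps)
  then have "V t \<le> V (s + real m * T)" using t T by (intro mono) simp_all
  also have "\<dots> \<le> \<rho> ^ m * V s" by (rule iter)
  also have "\<rho> ^ m = exp (ln \<rho> * real m)" using \<rho> by (simp add: exp_of_nat2_mult)
  also have "exp (ln \<rho> * real m) \<le> exp (ln \<rho> * ((t - s) / T - 1))"
    using m \<rho> by (simp add: mult_left_mono_neg)
  also have "\<dots> = (1 / \<rho>) * exp (ln \<rho> / T * (t - s))"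
  proof -
    have "ln \<rho> * ((t - s) / T - 1) = ln \<rho> / T * (t - s) - ln \<rho>"
      by (simp add: right_diff_distrib diff_divide_distrib)
    then show ?thesis using \<rho> by (simp add: exp_diff)
  qed
  finally show ?thesis using nonneg[OF t(1)] by (simp add: mult_right_mono)
qed

section \<open>Switched gradient flows\<close>

text \<open>
  With respect to the inner product given by \<open>P = Q\<^sup>-\<^sup>1\<close>, the vector \<open>2 Q M\<^sub>p x\<close> is the gradient of
  the quadratic form of \<open>M\<^sub>p\<close>; so \<open>z' = - Q M\<^sub>\<sigma> z\<close> is a steepest descent whose potential switches.
\<close>

locale switched_gradient_flow = dwell_time +
  fixes d n0 :: nat and Q P :: "real mat" and M :: "nat \<Rightarrow> real mat" and \<sigma> :: "real \<Rightarrow> nat"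
  assumes Q_carrier: "Q \<in> carrier_mat d d"
    and P_spd: "symmetric_positive_definite d P" and P_inverse: "P * Q = 1\<^sub>m d"
    and M_psd: "\<And>p. p \<in> {1..n0} \<Longrightarrow> symmetric_psd d (M p)"
    and \<sigma>_range: "\<And>t. 0 \<le> t \<Longrightarrow> \<sigma> t \<in> {1..n0}"
    and \<sigma>_const: "\<And>j t. ts j \<le> t \<Longrightarrow> t < ts (Suc j) \<Longrightarrow> \<sigma> t = \<sigma> (ts j)"
begin

abbreviation dissipation :: "nat \<Rightarrow> real vec \<Rightarrow> real" where
  "dissipation p x \<equiv> x \<bullet> (M p *\<^sub>v x)"

abbreviation energy :: "real vec \<Rightarrow> real" where
  "energy x \<equiv> x \<bullet> (P *\<^sub>v x)"

abbreviation solution :: "(real \<Rightarrow> real vec) \<Rightarrow> bool" where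
  "solution z \<equiv> ltv_solution d (\<lambda>t. - (Q * M (\<sigma> t))) (range ts) z"

lemma P_psd: "symmetric_psd d P"
  using P_spd by (rule spd_imp_psd)

lemmas P_carrier = psdD(1)[OF P_psd]
lemmas M_carrier = psdD(1)[OF M_psd]

lemma energy_nonneg: "x \<in> carrier_vec d \<Longrightarrow> 0 \<le> energy x"
  by (rule psdD(3)[OF P_psd])

lemma dissipation_nonneg: "p \<in> {1..n0} \<Longrightarrow> x \<in> carrier_vec d \<Longrightarrow> 0 \<le> dissipation p x"
  by (rule psdD(3)[OF M_psd])

lemma solution_carrier: "solution z \<Longrightarrow> 0 \<le> t \<Longrightarrow> z t \<in> carrier_vec d"
  by (simp add: ltv_solution_def)

lemma solution_continuous: "solution z \<Longrightarrow> i < d \<Longrightarrow> continuous_on {0..} (\<lambda>t. z t $ i)"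
  by (simp add: ltv_solution_def)

lemma solution_velocity:
  assumes z: "solution z" and t: "0 \<le> t" "t \<notin> range ts" and i: "i < d"
  shows "((\<lambda>s. z s $ i) has_real_derivative (- (Q *\<^sub>v (M (\<sigma> t) *\<^sub>v z t))) $ i) (at t within {0..})"
proof -
  have "- (Q * M (\<sigma> t)) *\<^sub>v z t = - (Q *\<^sub>v (M (\<sigma> t) *\<^sub>v z t))"
    using solution_carrier[OF z t(1)] Q_carrier M_carrier[OF \<sigma>_range[OF t(1)]]
    by (subst uminus_mult_mat_vec) (auto simp: assoc_mult_mat_vec[of _ d d _ d])
  moreover have "((\<lambda>s. z s $ i) has_real_derivative (- (Q * M (\<sigma> t)) *\<^sub>v z t) $ i) (at t within {0..})"
    using assms unfolding ltv_solution_def by blast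
  ultimately show ?thesis by simp
qed

text \<open>The factor \<open>Q\<close> of the velocity cancels against the metric \<open>P\<close>.\<close>

lemma energy_derivative:
  assumes z: "solution z" and t: "0 \<le> t" "t \<notin> range ts"
  shows "((\<lambda>s. energy (z s)) has_real_derivative - 2 * dissipation (\<sigma> t) (z t)) (at t within {0..})"
proof -
  let ?y = "M (\<sigma> t) *\<^sub>v z t"
  have zt: "z t \<in> carrier_vec d" using z t(1) by (rule solution_carrier)
  have y: "?y \<in> carrier_vec d" using M_carrier[OF \<sigma>_range[OF t(1)]] zt by simp
  have Qy: "Q *\<^sub>v ?y \<in> carrier_vec d" using Q_carrier y by simp
  have "P *\<^sub>v (Q *\<^sub>v ?y) = ?y"
    using P_inverse P_carrier Q_carrier y by (simp flip: assoc_mult_mat_vec[of _ d d _ d])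
  moreover have "P *\<^sub>v (- (Q *\<^sub>v ?y)) = - (P *\<^sub>v (Q *\<^sub>v ?y))"
    using P_carrier Q_carrier Qy by (intro eq_vecI) auto
  ultimately have PQ: "P *\<^sub>v (- (Q *\<^sub>v ?y)) = - ?y" by simp
  have "((\<lambda>s. energy (z s)) has_real_derivative
      (- (Q *\<^sub>v ?y)) \<bullet> (P *\<^sub>v z t) + z t \<bullet> (P *\<^sub>v (- (Q *\<^sub>v ?y)))) (at t within {0..})"
    using t(1) Qy solution_carrier[OF z] solution_velocity[OF z t]
    by (intro has_derivative_bilinear_form[OF P_carrier]) auto
  also have "(- (Q *\<^sub>v ?y)) \<bullet> (P *\<^sub>v z t) = z t \<bullet> (P *\<^sub>v (- (Q *\<^sub>v ?y)))"
    using Qy zt by (intro bilinear_form_symmetric[OF psdD(1,2)[OF P_psd]]) auto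
  also have "z t \<bullet> (P *\<^sub>v (- (Q *\<^sub>v ?y))) = - (z t \<bullet> ?y)"
    unfolding PQ using y zt by (intro scalar_prod_uminus_right) (simp only: carrier_vecD)
  finally show ?thesis by simp
qed

lemma energy_continuous: "solution z \<Longrightarrow> continuous_on {0..} (\<lambda>s. energy (z s))"
  by (intro continuous_on_bilinear_form[OF P_carrier] solution_continuous)
     (auto intro: solution_carrier)

lemma energy_antimono:
  assumes z: "solution z" and "0 \<le> s" "s \<le> t"
  shows "energy (z t) \<le> energy (z s)"
proof (rule nonincreasing_if_deriv_nonpos[OF assms(2,3) energy_continuous[OF z]])
  fix u assume u: "s < u" "u < t" "u \<notin> range ts"
  then have "0 \<le> u" using assms by simp
  with energy_derivative[OF z this u(3)] dissipation_nonneg[OF \<sigma>_range solution_carrier[OF z]]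
  show "\<exists>D\<le>0. ((\<lambda>s. energy (z s)) has_real_derivative D) (at u within {0..})"
    by (intro exI[of _ "- 2 * dissipation (\<sigma> u) (z u)"]) auto
qed

definition velocity_const :: "real \<Rightarrow> bool" where
  "velocity_const K \<longleftrightarrow> K > 0 \<and> (\<forall>p\<in>{1..n0}. \<forall>x\<in>carrier_vec d.
      (Q *\<^sub>v (M p *\<^sub>v x)) \<bullet> (Q *\<^sub>v (M p *\<^sub>v x)) \<le> K * dissipation p x)"

lemma ex_velocity_const: "\<exists>K. velocity_const K"
  unfolding velocity_const_def
proof (rule uniform_constant_finite_family)
  fix p assume p: "p \<in> {1..n0}"
  obtain k1 where k1: "k1 > 0" "\<And>x. x \<in> carrier_vec d \<Longrightarrow> (Q *\<^sub>v x) \<bullet> (Q *\<^sub>v x) \<le> k1 * (x \<bullet> x)"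
    using mat_vec_norm_bounded[OF Q_carrier] by auto
  obtain k2 where k2: "k2 > 0" "\<And>x. x \<in> carrier_vec d \<Longrightarrow> (M p *\<^sub>v x) \<bullet> (M p *\<^sub>v x) \<le> k2 * dissipation p x"
    using psd_norm_le_form[OF M_psd[OF p]] by auto
  have "(Q *\<^sub>v (M p *\<^sub>v x)) \<bullet> (Q *\<^sub>v (M p *\<^sub>v x)) \<le> k1 * k2 * dissipation p x" if x: "x \<in> carrier_vec d" for x
  proof -
    have "(Q *\<^sub>v (M p *\<^sub>v x)) \<bullet> (Q *\<^sub>v (M p *\<^sub>v x)) \<le> k1 * ((M p *\<^sub>v x) \<bullet> (M p *\<^sub>v x))"
      using M_carrier[OF p] x by (intro k1(2)) auto
    also have "\<dots> \<le> k1 * (k2 * dissipation p x)" using k1(1) k2(2)[OF x] by simp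
    finally show ?thesis by simp
  qed
  then show "\<exists>K>0. \<forall>x\<in>carrier_vec d. (Q *\<^sub>v (M p *\<^sub>v x)) \<bullet> (Q *\<^sub>v (M p *\<^sub>v x)) \<le> K * dissipation p x"
    using k1(1) k2(1) by (intro exI[of _ "k1 * k2"]) auto
qed (auto intro: dissipation_nonneg)

text \<open>
  Formally, \<open>|z(s) - z(a)|\<close> is at most the integral of the speed, whose square is at most \<open>T\<close> times
  the integral of the squared speed, hence at most \<open>T K / 2\<close> times the energy drop. Integrals and
  square roots are avoided by applying Young's inequality to the velocity in the fixed direction
  \<open>w = z(s) - z(a)\<close>: it makes the function \<open>f\<close> of the proof nonincreasing, and \<open>f s \<le> f a\<close>
  yields the claim.
\<close>

lemma displacement_le_energy_drop:
  assumes K: "velocity_const K" and z: "solution z"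
    and T: "T > 0" and s: "0 \<le> a" "a \<le> s" "s - a \<le> T"
  shows "(z s - z a) \<bullet> (z s - z a) \<le> T * K / 2 * (energy (z a) - energy (z s))"
proof -
  define w where "w = z s - z a"
  have zc: "z s \<in> carrier_vec d" "z a \<in> carrier_vec d"
    using solution_carrier[OF z] s by auto
  then have w: "w \<in> carrier_vec d" by (simp add: w_def)
  \<comment> \<open>The weight \<open>T\<^sup>2 K / 2\<close> makes the energy term absorb \<open>T\<^sup>2 |v|\<^sup>2\<close>.\<close>
  define f where "f t = 2 * T * (w \<bullet> (1\<^sub>m d *\<^sub>v z t)) - t * (w \<bullet> w) + T\<^sup>2 * K / 2 * energy (z t)" for t
  have "f s \<le> f a"
  proof (rule nonincreasing_if_deriv_nonpos[OF s(1,2)])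
    show "continuous_on {0..} f"
      unfolding f_def using solution_carrier[OF z] solution_continuous[OF z]
      by (intro continuous_intros energy_continuous[OF z] continuous_on_bilinear_form[of _ d]) auto
  next
    fix t assume t': "a < t" "t < s" "t \<notin> range ts"
    then have t: "0 \<le> t" "t \<notin> range ts" using s by auto
    have zt: "z t \<in> carrier_vec d" using z t(1) by (rule solution_carrier)
    have p: "\<sigma> t \<in> {1..n0}" by (rule \<sigma>_range[OF t(1)])
    define v where "v = Q *\<^sub>v (M (\<sigma> t) *\<^sub>v z t)"
    have v: "v \<in> carrier_vec d"
      using Q_carrier M_carrier[OF p] zt by (simp add: v_def)
    have "((\<lambda>s. w \<bullet> (1\<^sub>m d *\<^sub>v z s)) has_real_derivative
        0\<^sub>v d \<bullet> (1\<^sub>m d *\<^sub>v z t) + w \<bullet> (1\<^sub>m d *\<^sub>v (- v))) (at t within {0..})"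
      using t(1) w v solution_carrier[OF z] solution_velocity[OF z t]
      by (intro has_derivative_bilinear_form[of _ d]) (auto simp: v_def)
    then have "((\<lambda>s. w \<bullet> (1\<^sub>m d *\<^sub>v z s)) has_real_derivative - (w \<bullet> v)) (at t within {0..})"
      using w v zt by simp
    then have "(f has_real_derivative
        2 * T * (- (w \<bullet> v)) - 1 * (w \<bullet> w) + T\<^sup>2 * K / 2 * (- 2 * dissipation (\<sigma> t) (z t))) (at t within {0..})"
      unfolding f_def
      by (intro DERIV_add DERIV_diff DERIV_cmult DERIV_cmult_right DERIV_ident energy_derivative[OF z t])
    moreover have "2 * T * (- (w \<bullet> v)) - 1 * (w \<bullet> w) + T\<^sup>2 * K / 2 * (- 2 * dissipation (\<sigma> t) (z t)) \<le> 0"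
    proof -
      have "v \<bullet> v \<le> K * dissipation (\<sigma> t) (z t)"
        using K p zt by (simp add: velocity_const_def v_def)
      then have "T\<^sup>2 * (v \<bullet> v) \<le> T\<^sup>2 * (K * dissipation (\<sigma> t) (z t))"
        by (rule mult_left_mono) simp
      \<comment> \<open>Young's inequality: \<open>- 2 T w \<cdot> v \<le> |w|\<^sup>2 + T\<^sup>2 |v|\<^sup>2\<close>.\<close>
      moreover have "0 \<le> (w + T \<cdot>\<^sub>v v) \<bullet> (1\<^sub>m d *\<^sub>v (w + T \<cdot>\<^sub>v v))"
        using w v by simp
      then have "0 \<le> w \<bullet> w + 2 * T * (w \<bullet> v) + T\<^sup>2 * (v \<bullet> v)"
        using quadratic_form_add_smult[of "1\<^sub>m d" d w v T] comm_scalar_prod[OF v w] w v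
        by (simp del: self_scalar_prod_nonneg)
      ultimately show ?thesis by (simp add: algebra_simps)
    qed
    ultimately show "\<exists>D\<le>0. (f has_real_derivative D) (at t within {0..})" by blast
  qed
  moreover have "w \<bullet> w = w \<bullet> z s - w \<bullet> z a"
    using w zc by (simp add: w_def scalar_prod_minus_distrib[of _ d])
  moreover have "f s - f a = 2 * T * (w \<bullet> z s - w \<bullet> z a) - (s - a) * (w \<bullet> w)
        - T\<^sup>2 * K / 2 * (energy (z a) - energy (z s))"
    using zc by (simp add: f_def algebra_simps)
  ultimately have "f s - f a = 2 * (T * (w \<bullet> w)) - (s - a) * (w \<bullet> w)
        - T\<^sup>2 * K / 2 * (energy (z a) - energy (z s))" and "f s \<le> f a"
    by simp_all
  moreover have "(s - a) * (w \<bullet> w) \<le> T * (w \<bullet> w)"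
    using s by (intro mult_right_mono) auto
  ultimately have "T * (w \<bullet> w) \<le> T\<^sup>2 * K / 2 * (energy (z a) - energy (z s))"
    by linarith
  also have "\<dots> = T * (T * K / 2 * (energy (z a) - energy (z s)))"
    by (simp add: power2_eq_square)
  finally show ?thesis using T by (simp add: w_def)
qed

text \<open>
  Between the \<open>j\<close>-th switching instant and the next one, while one mode stays active, the state is still close to \<open>z a\<close>, so that the dissipation stays above the constant \<open>\<beta>\<close> of the
  proof. If \<open>\<beta>\<close> is positive, then the energy drops by at least \<open>2 \<beta> \<tau>\<close> during this interval, which is
  at least as long as the dwell time.
\<close>

lemma dissipation_le_energy_drop:
  assumes K: "velocity_const K" and z: "solution z" and T: "T > 0"
    and B: "B > 0" "\<And>x. x \<in> carrier_vec d \<Longrightarrow> dissipation (\<sigma> (ts j)) x \<le> B * (x \<bullet> x)"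
    and a: "0 \<le> a" "a \<le> ts j" and b: "ts (Suc j) \<le> b" "b - a \<le> T"
  shows "dissipation (\<sigma> (ts j)) (z a) \<le> (1 / \<tau> + B * T * K) * (energy (z a) - energy (z b))"
proof -
  let ?p = "\<sigma> (ts j)"
  define \<delta> where "\<delta> = energy (z a) - energy (z b)"
  define \<beta> where "\<beta> = dissipation ?p (z a) / 2 - B * (T * K / 2 * \<delta>)"
  have K0: "K > 0" using K by (simp add: velocity_const_def)
  have jj: "ts j + \<tau> \<le> ts (Suc j)" using dwell[of j] by simp
  have "a \<le> b" using a b jj tau_pos by linarith
  then have \<delta>: "0 \<le> \<delta>" using energy_antimono[OF z a(1)] by (simp add: \<delta>_def)
  have p: "?p \<in> {1..n0}" by (rule \<sigma>_range[OF ts_nonneg])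
  have za: "z a \<in> carrier_vec d" using z a(1) by (rule solution_carrier)
  have low: "\<beta> \<le> dissipation ?p (z t)" if t: "ts j \<le> t" "t \<le> ts (Suc j)" for t
  proof -
    have t0: "0 \<le> t" using t a by linarith
    have zt: "z t \<in> carrier_vec d" using z t0 by (rule solution_carrier)
    have "(z t - z a) \<bullet> (z t - z a) \<le> T * K / 2 * (energy (z a) - energy (z t))"
      using t a b T by (intro displacement_le_energy_drop[OF K z]) auto
    also have "\<dots> \<le> T * K / 2 * \<delta>"
      unfolding \<delta>_def using energy_antimono[OF z t0, of b] t b T K0 by (intro mult_left_mono) auto
    finally have "B * ((z t - z a) \<bullet> (z t - z a)) \<le> B * (T * K / 2 * \<delta>)"
      using B(1) by simp
    moreover have "dissipation ?p (z t - z a) \<le> B * ((z t - z a) \<bullet> (z t - z a))"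
      using zt za by (intro B(2)) simp
    moreover have "dissipation ?p (z a) \<le> 2 * dissipation ?p (z t) + 2 * dissipation ?p (z t - z a)"
      by (rule psd_form_diff_le[OF M_psd[OF p] zt za])
    ultimately show ?thesis unfolding \<beta>_def by linarith
  qed
  have "energy (z (ts (Suc j))) + 2 * \<beta> * ts (Suc j) \<le> energy (z (ts j)) + 2 * \<beta> * ts j"
  proof (rule nonincreasing_if_deriv_nonpos[where f = "\<lambda>t. energy (z t) + 2 * \<beta> * t"])
    show "continuous_on {0..} (\<lambda>t. energy (z t) + 2 * \<beta> * t)"
      by (intro continuous_intros energy_continuous[OF z])
  next
    fix t assume t: "ts j < t" "t < ts (Suc j)" "t \<notin> range ts"
    then have t0: "0 \<le> t" using a by linarith
    have "\<sigma> t = ?p" using t by (intro \<sigma>_const) auto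
    then have "((\<lambda>t. energy (z t) + 2 * \<beta> * t) has_real_derivative
        - 2 * dissipation ?p (z t) + 2 * \<beta> * 1) (at t within {0..})"
      using energy_derivative[OF z t0 t(3)]
      by (intro DERIV_add DERIV_cmult DERIV_ident) simp
    moreover have "- 2 * dissipation ?p (z t) + 2 * \<beta> * 1 \<le> 0" using low[of t] t by simp
    ultimately show "\<exists>D\<le>0. ((\<lambda>t. energy (z t) + 2 * \<beta> * t) has_real_derivative D) (at t within {0..})"
      by blast
  qed (use jj tau_pos ts_nonneg in auto)
  moreover have "energy (z (ts j)) \<le> energy (z a)" "energy (z b) \<le> energy (z (ts (Suc j)))"
    using energy_antimono[OF z] a b ts_nonneg by auto
  ultimately have len: "2 * \<beta> * (ts (Suc j) - ts j) \<le> \<delta>"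
    unfolding \<delta>_def by (simp add: algebra_simps)
  have "2 * \<beta> * \<tau> \<le> \<delta>"
  proof (cases "0 \<le> \<beta>")
    case True
    then have "2 * \<beta> * \<tau> \<le> 2 * \<beta> * (ts (Suc j) - ts j)" using jj by (intro mult_left_mono) auto
    then show ?thesis using len by linarith
  next
    case False
    then have "2 * \<beta> * \<tau> \<le> 0" using tau_pos by (simp add: mult_nonpos_nonneg)
    then show ?thesis using \<delta> by linarith
  qed
  then have "2 * \<beta> \<le> \<delta> / \<tau>" using tau_pos by (simp add: field_simps)
  then have "dissipation ?p (z a) \<le> (1 / \<tau> + B * T * K) * \<delta>"
    by (simp add: \<beta>_def algebra_simps)
  then show ?thesis by (simp add: \<delta>_def)
qed

text \<open>
  Every window determines the set \<open>S\<close> of modes which occur in it. The coercivity constant depends on the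
  window through \<open>S\<close> only, and \<open>S\<close> ranges over the finite collection \<open>\<S>\<close> of jointly definite sets of modes; this is what makes
  the factor \<open>\<rho>\<close> independent of the window.
\<close>

lemma energy_contracts_on_window:
  assumes T: "T > 0" and J: "strict_mono J"
    and window: "\<And>k. ts (J (Suc k)) - ts (J k) \<le> T"
    and definite: "\<And>k x. x \<in> carrier_vec d \<Longrightarrow>
          (\<And>j. j \<in> {J k..<J (Suc k)} \<Longrightarrow> dissipation (\<sigma> (ts j)) x = 0) \<Longrightarrow> x = 0\<^sub>v d"
  shows "\<exists>\<rho>. 0 < \<rho> \<and> \<rho> < 1 \<and>
           (\<forall>z k. solution z \<longrightarrow> energy (z (ts (J (Suc k)))) \<le> \<rho> * energy (z (ts (J k))))"
proof -
  obtain K where K: "velocity_const K" using ex_velocity_const by blast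
  have K0: "K > 0" using K by (simp add: velocity_const_def)
  have "\<exists>B>0. \<forall>p\<in>{1..n0}. \<forall>x\<in>carrier_vec d. dissipation p x \<le> B * (x \<bullet> x)"
    by (intro uniform_constant_finite_family quadratic_form_bounded M_carrier) auto
  then obtain B where B: "B > 0"
    "\<And>p x. p \<in> {1..n0} \<Longrightarrow> x \<in> carrier_vec d \<Longrightarrow> dissipation p x \<le> B * (x \<bullet> x)" by blast
  define \<S> where "\<S> = {S. S \<subseteq> {1..n0} \<and>
    (\<forall>x\<in>carrier_vec d. (\<forall>p\<in>S. dissipation p x = 0) \<longrightarrow> x = 0\<^sub>v d)}"
  have fin: "finite S" if "S \<in> \<S>" for S
    using that finite_subset[of S "{1..n0}"] by (auto simp: \<S>_def)
  have "\<exists>H>0. \<forall>S\<in>\<S>. \<forall>x\<in>carrier_vec d. x \<bullet> x \<le> H * (\<Sum>p\<in>S. dissipation p x)"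
  proof (rule uniform_constant_finite_family)
    show "finite \<S>" by (rule finite_subset[of _ "Pow {1..n0}"]) (auto simp: \<S>_def)
    fix S assume S: "S \<in> \<S>"
    show "\<exists>H>0. \<forall>x\<in>carrier_vec d. x \<bullet> x \<le> H * (\<Sum>p\<in>S. dissipation p x)"
      using S by (intro joint_psd_coercive fin[OF S] M_psd) (auto simp: \<S>_def)
    fix x :: "real vec" assume "x \<in> carrier_vec d"
    then show "0 \<le> (\<Sum>p\<in>S. dissipation p x)"
      using S by (intro sum_nonneg dissipation_nonneg) (auto simp: \<S>_def)
  qed
  then obtain H where H: "H > 0"
    "\<And>S x. S \<in> \<S> \<Longrightarrow> x \<in> carrier_vec d \<Longrightarrow> x \<bullet> x \<le> H * (\<Sum>p\<in>S. dissipation p x)" by blast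
  obtain c where c: "c > 0" "\<And>x. x \<in> carrier_vec d \<Longrightarrow> energy x \<le> c * (x \<bullet> x)"
    using quadratic_form_bounded[OF P_carrier] by blast
  define L where "L = 1 / \<tau> + B * T * K"
  have L: "L > 0" using tau_pos B(1) T K0 by (simp add: L_def add_pos_pos)
  \<comment> \<open>The summand 2 ensures \<open>\<Gamma> > 1\<close>, so that \<open>1 - 1 / \<Gamma>\<close> lies strictly between 0 and 1.\<close>
  define \<Gamma> where "\<Gamma> = c * H * real n0 * L + 2"
  have \<Gamma>: "\<Gamma> \<ge> 2" using c(1) H(1) L by (simp add: \<Gamma>_def)
  have contr: "energy (z (ts (J (Suc k)))) \<le> (1 - 1 / \<Gamma>) * energy (z (ts (J k)))"
    if z: "solution z" for z k
  proof -
    define a where "a = ts (J k)"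
    define b where "b = ts (J (Suc k))"
    define \<delta> where "\<delta> = energy (z a) - energy (z b)"
    have ab: "0 \<le> a" "a \<le> b" "b - a \<le> T"
      using strict_mono_leD[OF J, of k "Suc k"] window[of k] ts_nonneg ts_le_iff by (auto simp: a_def b_def)
    have za: "z a \<in> carrier_vec d" using z ab(1) by (rule solution_carrier)
    have \<delta>: "0 \<le> \<delta>" using energy_antimono[OF z ab(1,2)] by (simp add: \<delta>_def)
    define S where "S = (\<lambda>j. \<sigma> (ts j)) ` {J k..<J (Suc k)}"
    have S_sub: "S \<subseteq> {1..n0}" using \<sigma>_range ts_nonneg unfolding S_def by blast
    have S: "S \<in> \<S>" using S_sub definite[of _ k] by (auto simp: \<S>_def S_def)
    have "dissipation p (z a) \<le> L * \<delta>" if p: "p \<in> S" for p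
    proof -
      obtain j where j: "j \<in> {J k..<J (Suc k)}" "p = \<sigma> (ts j)" using p unfolding S_def by blast
      show ?thesis
        unfolding j(2) L_def \<delta>_def
        using j S_sub p ab ts_le_iff B
        by (intro dissipation_le_energy_drop[OF K z T]) (auto simp: a_def b_def Suc_le_eq)
    qed
    then have "(\<Sum>p\<in>S. dissipation p (z a)) \<le> real (card S) * (L * \<delta>)"
      using sum_bounded_above[of S "\<lambda>p. dissipation p (z a)" "L * \<delta>"] by simp
    also have "\<dots> \<le> real n0 * (L * \<delta>)"
      using card_mono[OF _ S_sub] L \<delta> by (intro mult_right_mono) auto
    finally have sum: "(\<Sum>p\<in>S. dissipation p (z a)) \<le> real n0 * (L * \<delta>)" .
    have "energy (z a) \<le> c * (z a \<bullet> z a)" using za by (rule c(2))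
    also have "\<dots> \<le> c * (H * (\<Sum>p\<in>S. dissipation p (z a)))"
      using c(1) H(2)[OF S za] by simp
    also have "\<dots> \<le> c * (H * (real n0 * (L * \<delta>)))"
      using c(1) H(1) sum by simp
    also have "\<dots> \<le> \<Gamma> * \<delta>" using \<delta> by (simp add: \<Gamma>_def algebra_simps)
    finally have "energy (z a) \<le> \<Gamma> * (energy (z a) - energy (z b))" by (simp add: \<delta>_def)
    then show ?thesis using \<Gamma> by (simp add: a_def b_def field_simps)
  qed
  then show ?thesis using \<Gamma> by (intro exI[of _ "1 - 1 / \<Gamma>"]) auto
qed

text \<open>
  Whatever the initial time \<open>t\<close>, the interval from \<open>t\<close> to \<open>t + 2 T\<close> contains a complete window: the
  first one that does not start before \<open>t\<close> starts at \<open>t + T\<close> at the latest. So the energy contracts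
  over every interval of length \<open>2 T\<close>.
\<close>

theorem exponentially_stable_if_jointly_definite:
  assumes T: "T > 0" and J: "strict_mono J" "ts (J 0) = 0"
    and window: "\<And>k. ts (J (Suc k)) - ts (J k) \<le> T"
    and definite: "\<And>k x. x \<in> carrier_vec d \<Longrightarrow>
          (\<And>j. j \<in> {J k..<J (Suc k)} \<Longrightarrow> dissipation (\<sigma> (ts j)) x = 0) \<Longrightarrow> x = 0\<^sub>v d"
  shows "exponentially_stable d (\<lambda>t. - (Q * M (\<sigma> t))) (range ts)"
proof -
  have "\<exists>\<rho>. 0 < \<rho> \<and> \<rho> < 1 \<and>
      (\<forall>z k. solution z \<longrightarrow> energy (z (ts (J (Suc k)))) \<le> \<rho> * energy (z (ts (J k))))"
    by (rule energy_contracts_on_window[where J = J, OF T J(1) window]) (rule definite)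
  then obtain \<rho> where \<rho>: "0 < \<rho>" "\<rho> < 1"
    and step: "\<And>z k. solution z \<Longrightarrow> energy (z (ts (J (Suc k)))) \<le> \<rho> * energy (z (ts (J k)))"
    by blast
  have contr: "energy (z (t + 2 * T)) \<le> \<rho> * energy (z t)" if z: "solution z" and t: "0 \<le> t" for z t
  proof -
    have "\<exists>k. t \<le> ts (J k)"
    proof -
      obtain j where "t \<le> ts j" using ts_unbounded by blast
      also have "ts j \<le> ts (J j)" using ts_le_iff strict_mono_imp_increasing[OF J(1)] by blast
      finally show ?thesis by blast
    qed
    define k where "k = (LEAST k. t \<le> ts (J k))"
    have k: "t \<le> ts (J k)" unfolding k_def by (rule LeastI_ex) fact
    have k': "ts (J k) \<le> t + T"
    proof (cases k)
      case 0
      then show ?thesis using J(2) t T by simp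
    next
      case (Suc i)
      then have "\<not> t \<le> ts (J i)" using not_less_Least[of i "\<lambda>k. t \<le> ts (J k)"] by (simp add: k_def)
      then show ?thesis using window[of i] Suc by simp
    qed
    have "energy (z (t + 2 * T)) \<le> energy (z (ts (J (Suc k))))"
      using k' window[of k] ts_nonneg by (intro energy_antimono[OF z]) auto
    also have "\<dots> \<le> \<rho> * energy (z (ts (J k)))" by (rule step[OF z])
    also have "\<dots> \<le> \<rho> * energy (z t)"
      using \<rho>(1) energy_antimono[OF z t k] by simp
    finally show ?thesis .
  qed
  obtain c1 where c1: "c1 > 0" "\<And>x. x \<in> carrier_vec d \<Longrightarrow> x \<bullet> x \<le> c1 * energy x"
    using spd_coercive[OF P_spd] by blast
  obtain c2 where c2: "c2 > 0" "\<And>x. x \<in> carrier_vec d \<Longrightarrow> energy x \<le> c2 * (x \<bullet> x)"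
    using quadratic_form_bounded[OF P_carrier] by blast
  define r where "r = - ln \<rho> / (4 * T)"
  define C where "C = sqrt (c1 * c2 / \<rho>)"
  have "C > 0" using c1(1) c2(1) \<rho>(1) by (simp add: C_def)
  moreover have "r > 0" using \<rho> T by (simp add: r_def divide_neg_pos)
  moreover have "vec_norm2 (z t) \<le> C * exp (- r * (t - s)) * vec_norm2 (z s)"
    if z: "solution z" and st: "0 \<le> s" "s \<le> t" for z s t
  proof -
    have zs: "z s \<in> carrier_vec d" and zt: "z t \<in> carrier_vec d"
      using solution_carrier[OF z] st by auto
    have e: "ln \<rho> / (2 * T) * (t - s) = 2 * (- r * (t - s))"
      using T by (simp add: r_def field_simps)
    have "z t \<bullet> z t \<le> c1 * energy (z t)" using zt by (rule c1(2))
    also have "energy (z t) \<le> 1 / \<rho> * exp (ln \<rho> / (2 * T) * (t - s)) * energy (z s)"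
      using T \<rho> st contr[OF z] energy_antimono[OF z] energy_nonneg[OF solution_carrier[OF z]]
      by (intro exponential_decay_of_uniform_contraction[where V = "\<lambda>t. energy (z t)"]) auto
    also have "\<dots> \<le> 1 / \<rho> * exp (ln \<rho> / (2 * T) * (t - s)) * (c2 * (z s \<bullet> z s))"
      using \<rho>(1) c2(2)[OF zs] by (intro mult_left_mono) auto
    finally have "z t \<bullet> z t \<le> c1 * (1 / \<rho> * exp (ln \<rho> / (2 * T) * (t - s)) * (c2 * (z s \<bullet> z s)))"
      using c1(1) by simp
    also have "\<dots> = c1 * c2 / \<rho> * (exp (- r * (t - s)))\<^sup>2 * (z s \<bullet> z s)"
      unfolding e exp_double by simp
    finally have "sqrt (z t \<bullet> z t) \<le> sqrt (c1 * c2 / \<rho> * (exp (- r * (t - s)))\<^sup>2 * (z s \<bullet> z s))"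
      by (rule real_sqrt_le_mono)
    also have "\<dots> = C * exp (- r * (t - s)) * sqrt (z s \<bullet> z s)"
      by (simp only: C_def real_sqrt_mult real_sqrt_abs abs_exp_cancel)
    finally show ?thesis unfolding vec_norm2_def .
  qed
  ultimately show ?thesis unfolding exponentially_stable_def by blast
qed

end

section \<open>Graph Laplacians\<close>

lemma connected_imp_constant:
  assumes conn: "Digraph_Component.connected (with_proj \<lparr>pverts = V, parcs = E\<rparr>)"
    and edge: "\<And>i j. (i, j) \<in> E \<Longrightarrow> f i = f j" and uv: "u \<in> V" "v \<in> V"
  shows "f u = f v"
proof -
  let ?H = "mk_symmetric (with_proj \<lparr>pverts = V, parcs = E\<rparr>)"
  have "u \<rightarrow>\<^sup>*\<^bsub>with_proj ?H\<^esub> v"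
    using conn uv by (auto simp: connected_def strongly_connected_def)
  then have "(u, v) \<in> rtrancl_on V (parcs ?H)"
    by (simp add: reachable_def)
  then show ?thesis
  proof (induction rule: rtrancl_on_induct)
    case (step x y)
    then have "(x, y) \<in> E \<or> (y, x) \<in> E" by (auto simp: parcs_mk_symmetric)
    then show ?case using step edge by metis
  qed simp
qed

lemma weighted_adjacency_nonneg:
  assumes "weighted_adjacency N G W" "i < N" "j < N"
  shows "0 \<le> W $$ (i,j)"
  using assms unfolding weighted_adjacency_def by (cases "i = j"; cases "(j, i) \<in> parcs G") (auto intro: less_imp_le)

text \<open>
  The \<open>i\<close>-th subvector of length \<open>n\<close>, in the ordering of indices used by \<^const>\<open>kronecker\<close>.
\<close>

definition block :: "nat \<Rightarrow> 'a vec \<Rightarrow> nat \<Rightarrow> 'a vec" where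
  "block n y i = vec n (\<lambda>c. y $ (i * n + c))"

lemma sum_lessThan_mult:
  fixes f :: "nat \<Rightarrow> 'a::comm_monoid_add"
  shows "(\<Sum>a<N * n. f a) = (\<Sum>i<N. \<Sum>c<n. f (i * n + c))"
proof -
  have "sum f {i * n..<i * n + n} = (\<Sum>c<n. f (i * n + c))" for i
    using sum.shift_bounds_nat_ivl[of f 0 "i * n" n] by (simp add: add.commute atLeast0LessThan)
  then show ?thesis using sum.nat_group[of f n N] by simp
qed

lemma block_index_less: "i < N \<Longrightarrow> c < n \<Longrightarrow> i * n + c < N * (n::nat)"
  using mult_le_mono1[of "Suc i" N n] by simp

lemma laplacian_form:
  assumes W: "W \<in> carrier_mat N N" "transpose_mat W = W" "\<And>i. i < N \<Longrightarrow> W $$ (i,i) = 0"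
  shows "(\<Sum>i<N. \<Sum>j<N. u i * (laplacian W $$ (i,j) * u j)) =
           (1/2) * (\<Sum>i<N. \<Sum>j<N. W $$ (i,j) * (u i - u j)\<^sup>2)"
proof -
  have sym: "W $$ (i,j) = W $$ (j,i)" if "i < N" "j < N" for i j
    using that W(1,2) by (metis carrier_matD index_transpose_mat(1))
  have row: "(\<Sum>j<N. u i * (laplacian W $$ (i,j) * u j)) = (\<Sum>j<N. W $$ (i,j) * (u i)\<^sup>2 - W $$ (i,j) * (u i * u j))"
    if i: "i < N" for i
  proof -
    have "(\<Sum>j<N. u i * (laplacian W $$ (i,j) * u j)) =
      (\<Sum>j<N. (if j = i then (\<Sum>k<N. W $$ (i,k)) * (u i)\<^sup>2 else 0) - W $$ (i,j) * (u i * u j))"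
      using i W(1,3) by (intro sum.cong) (auto simp: laplacian_def power2_eq_square)
    also have "\<dots> = (\<Sum>j<N. W $$ (i,j) * (u i)\<^sup>2 - W $$ (i,j) * (u i * u j))"
      using i by (simp add: sum_subtractf sum_distrib_right)
    finally show ?thesis .
  qed
  have swap: "(\<Sum>i<N. \<Sum>j<N. W $$ (i,j) * (u j)\<^sup>2) = (\<Sum>i<N. \<Sum>j<N. W $$ (i,j) * (u i)\<^sup>2)"
    by (subst sum.swap) (use sym in \<open>auto intro!: sum.cong\<close>)
  have "(\<Sum>i<N. \<Sum>j<N. W $$ (i,j) * (u i - u j)\<^sup>2) =
     (\<Sum>i<N. \<Sum>j<N. W $$ (i,j) * (u i)\<^sup>2) + (\<Sum>i<N. \<Sum>j<N. W $$ (i,j) * (u j)\<^sup>2)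
       - 2 * (\<Sum>i<N. \<Sum>j<N. W $$ (i,j) * (u i * u j))"
    unfolding sum_distrib_left sum.distrib[symmetric] sum_subtractf[symmetric]
    by (intro sum.cong refl) (simp add: power2_diff algebra_simps)
  then show ?thesis unfolding swap by (simp add: row sum_subtractf)
qed

lemma kronecker_laplacian_carrier:
  "W \<in> carrier_mat N N \<Longrightarrow> kronecker (laplacian W) (1\<^sub>m n) \<in> carrier_mat (N * n) (N * n)"
  by (simp add: kronecker_def laplacian_def)

lemma kronecker_laplacian_symmetric:
  assumes W: "W \<in> carrier_mat N N" "transpose_mat W = W"
  shows "transpose_mat (kronecker (laplacian W) (1\<^sub>m n)) = kronecker (laplacian W) (1\<^sub>m n)"
proof (rule eq_matI)
  have sym: "W $$ (i,j) = W $$ (j,i)" if "i < N" "j < N" for i j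
    using that W(1,2) by (metis carrier_matD index_transpose_mat(1))
  fix a b assume "a < dim_row (kronecker (laplacian W) (1\<^sub>m n))" "b < dim_col (kronecker (laplacian W) (1\<^sub>m n))"
  then have ab: "a < N * n" "b < N * n" using kronecker_laplacian_carrier[OF W(1), of n] by auto
  then have "n > 0" by (cases n) auto
  then have "a div n < N" "b div n < N" "a mod n < n" "b mod n < n"
    using ab by (auto simp: less_mult_imp_div_less)
  then show "transpose_mat (kronecker (laplacian W) (1\<^sub>m n)) $$ (a,b) = kronecker (laplacian W) (1\<^sub>m n) $$ (a,b)"
    using ab W(1) sym by (auto simp: kronecker_def laplacian_def)
qed (use W in \<open>auto simp: kronecker_def laplacian_def\<close>)

text \<open>
  The identity factor decouples the \<open>n\<close> coordinates, and each coordinate contributes a copy of the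
  scalar Laplacian form.
\<close>

lemma kronecker_laplacian_form:
  assumes W: "W \<in> carrier_mat N N" "transpose_mat W = W" "\<And>i. i < N \<Longrightarrow> W $$ (i,i) = 0"
    and y: "y \<in> carrier_vec (N * n)"
  shows "y \<bullet> (kronecker (laplacian W) (1\<^sub>m n) *\<^sub>v y) =
    (1/2) * (\<Sum>i<N. \<Sum>j<N. W $$ (i,j) * (\<Sum>c<n. (y $ (i * n + c) - y $ (j * n + c))\<^sup>2))"
proof -
  let ?K = "kronecker (laplacian W) (1\<^sub>m n)"
  let ?L = "laplacian W"
  have ent: "?K $$ (i * n + c, j * n + c') = (if c = c' then ?L $$ (i,j) else 0)"
    if "i < N" "j < N" "c < n" "c' < n" for i j c c'
  proof -
    have "i * n + c < N * n" "j * n + c' < N * n"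
      using that by (simp_all add: block_index_less)
    then show ?thesis using that W(1) by (simp add: kronecker_def laplacian_def)
  qed
  have "y \<bullet> (?K *\<^sub>v y) = (\<Sum>i<N. \<Sum>c<n. \<Sum>j<N. \<Sum>c'<n.
      y $ (i * n + c) * (?K $$ (i * n + c, j * n + c') * y $ (j * n + c')))"
    unfolding bilinear_form_sum[OF kronecker_laplacian_carrier[OF W(1)] y] sum_lessThan_mult ..
  also have "\<dots> = (\<Sum>i<N. \<Sum>c<n. \<Sum>j<N. y $ (i * n + c) * (?L $$ (i,j) * y $ (j * n + c)))"
  proof (intro sum.cong refl)
    fix i c j assume "i \<in> {..<N}" "c \<in> {..<n}" "j \<in> {..<N}"
    then have "(\<Sum>c'<n. y $ (i * n + c) * (?K $$ (i * n + c, j * n + c') * y $ (j * n + c')))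
      = (\<Sum>c'<n. if c' = c then y $ (i * n + c) * (?L $$ (i,j) * y $ (j * n + c)) else 0)"
      by (intro sum.cong refl) (auto simp: ent)
    then show "(\<Sum>c'<n. y $ (i * n + c) * (?K $$ (i * n + c, j * n + c') * y $ (j * n + c')))
      = y $ (i * n + c) * (?L $$ (i,j) * y $ (j * n + c))"
      using \<open>c \<in> {..<n}\<close> by simp
  qed
  also have "\<dots> = (\<Sum>c<n. \<Sum>i<N. \<Sum>j<N. y $ (i * n + c) * (?L $$ (i,j) * y $ (j * n + c)))"
    by (rule sum.swap)
  also have "\<dots> = (\<Sum>c<n. (1/2) * (\<Sum>i<N. \<Sum>j<N. W $$ (i,j) * (y $ (i * n + c) - y $ (j * n + c))\<^sup>2))"
    by (intro sum.cong refl laplacian_form[OF W])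
  also have "\<dots> = (1/2) * (\<Sum>c<n. \<Sum>i<N. \<Sum>j<N. W $$ (i,j) * (y $ (i * n + c) - y $ (j * n + c))\<^sup>2)"
    by (rule sum_distrib_left[symmetric])
  also have "(\<Sum>c<n. \<Sum>i<N. \<Sum>j<N. W $$ (i,j) * (y $ (i * n + c) - y $ (j * n + c))\<^sup>2)
      = (\<Sum>i<N. \<Sum>j<N. \<Sum>c<n. W $$ (i,j) * (y $ (i * n + c) - y $ (j * n + c))\<^sup>2)"
    by (subst sum.swap, rule sum.cong[OF refl], rule sum.swap)
  finally show ?thesis by (simp only: sum_distrib_left)
qed

text \<open>
  The form is a sum of the nonnegative terms \<open>W\<^sub>i\<^sub>j |y\<^sub>i - y\<^sub>j|\<^sup>2\<close>, which all vanish with it.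
\<close>

lemma kronecker_laplacian_form_zero_imp_blocks_eq:
  assumes W: "W \<in> carrier_mat N N" "transpose_mat W = W" "\<And>i. i < N \<Longrightarrow> W $$ (i,i) = 0"
    and nonneg: "\<And>i j. i < N \<Longrightarrow> j < N \<Longrightarrow> 0 \<le> W $$ (i,j)"
    and y: "y \<in> carrier_vec (N * n)"
    and zero: "y \<bullet> (kronecker (laplacian W) (1\<^sub>m n) *\<^sub>v y) = 0"
    and ij: "i < N" "j < N" "W $$ (i,j) > 0"
  shows "block n y i = block n y j"
proof -
  let ?g = "\<lambda>i j. W $$ (i,j) * (\<Sum>c<n. (y $ (i * n + c) - y $ (j * n + c))\<^sup>2)"
  have g: "0 \<le> ?g i j" if "i < N" "j < N" for i j
    using that nonneg by (simp add: sum_nonneg)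
  have "(\<Sum>i<N. \<Sum>j<N. ?g i j) = 0"
    using zero kronecker_laplacian_form[OF W y] by simp
  then have "(\<Sum>j<N. ?g i j) = 0"
    using ij g by (subst (asm) sum_nonneg_eq_0_iff) (auto intro!: sum_nonneg)
  then have "?g i j = 0"
    using sum_nonneg_eq_0_iff[of "{..<N}" "?g i"] ij g by fastforce
  then have "(\<Sum>c<n. (y $ (i * n + c) - y $ (j * n + c))\<^sup>2) = 0" using ij(3) by simp
  then have "\<forall>c<n. y $ (i * n + c) = y $ (j * n + c)"
    by (subst (asm) sum_nonneg_eq_0_iff) auto
  then show ?thesis by (auto simp: block_def)
qed

lemma psd_kronecker_laplacian:
  assumes W: "weighted_adjacency N G W"
  shows "symmetric_psd (N * n) (kronecker (laplacian W) (1\<^sub>m n))"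
proof -
  have W': "W \<in> carrier_mat N N" "transpose_mat W = W" "\<And>i. i < N \<Longrightarrow> W $$ (i,i) = 0"
    using W by (auto simp: weighted_adjacency_def)
  show ?thesis
    unfolding symmetric_psd_def
  proof (intro conjI ballI)
    fix y :: "real vec" assume y: "y \<in> carrier_vec (N * n)"
    show "0 \<le> y \<bullet> (kronecker (laplacian W) (1\<^sub>m n) *\<^sub>v y)"
      using weighted_adjacency_nonneg[OF W]
      by (subst kronecker_laplacian_form[OF W' y]) (auto intro!: sum_nonneg mult_nonneg_nonneg)
  qed (fact kronecker_laplacian_carrier[OF W'(1)] kronecker_laplacian_symmetric[OF W'(1,2)])+
qed

section \<open>Block diagonal matrices\<close>

lemma diag_block_mat_Cons_mult_vec:
  fixes A :: "'a::semiring_1 mat"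
  assumes "u \<in> carrier_vec (dim_col A)" "v \<in> carrier_vec (sum_list (map dim_col As))"
  shows "diag_block_mat (A # As) *\<^sub>v (u @\<^sub>v v) = (A *\<^sub>v u) @\<^sub>v (diag_block_mat As *\<^sub>v v)"
proof -
  let ?D = "diag_block_mat As"
  have v: "v \<in> carrier_vec (dim_col ?D)" using assms(2) by (simp add: dim_diag_block_mat)
  have "diag_block_mat (A # As) *\<^sub>v (u @\<^sub>v v) =
      (A *\<^sub>v u + 0\<^sub>m (dim_row A) (dim_col ?D) *\<^sub>v v) @\<^sub>v (0\<^sub>m (dim_row ?D) (dim_col A) *\<^sub>v u + ?D *\<^sub>v v)"
    unfolding diag_block_mat.simps Let_def
    by (rule four_block_mat_mult_vec[OF _ _ _ _ assms(1) v]) auto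
  moreover have "A *\<^sub>v u + 0\<^sub>m (dim_row A) (dim_col ?D) *\<^sub>v v = A *\<^sub>v u"
    "0\<^sub>m (dim_row ?D) (dim_col A) *\<^sub>v u + ?D *\<^sub>v v = ?D *\<^sub>v v"
    using assms(1) v by (auto intro!: eq_vecI)
  ultimately show ?thesis by simp
qed

lemma carrier_vec_add_split:
  assumes "x \<in> carrier_vec (k + l)"
  obtains u v where "u \<in> carrier_vec k" "v \<in> carrier_vec l" "x = u @\<^sub>v v"
  by (rule that[OF vec_first_carrier vec_last_carrier vec_first_last_append[OF assms, symmetric]])

lemma block_diag_block_mat_mult:
  fixes Bs :: "'a::semiring_1 mat list"
  assumes "\<forall>B\<in>set Bs. dim_row B = n" "x \<in> carrier_vec (sum_list (map dim_col Bs))" "i < length Bs"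
  shows "\<exists>v\<in>carrier_vec (dim_col (Bs ! i)). block n (diag_block_mat Bs *\<^sub>v x) i = Bs ! i *\<^sub>v v"
  using assms
proof (induction Bs arbitrary: x i)
  case (Cons B Bs)
  have "x \<in> carrier_vec (dim_col B + sum_list (map dim_col Bs))" using Cons.prems(2) by simp
  then obtain u v where uv: "u \<in> carrier_vec (dim_col B)" "v \<in> carrier_vec (sum_list (map dim_col Bs))" "x = u @\<^sub>v v"
    by (rule carrier_vec_add_split)
  have mult: "diag_block_mat (B # Bs) *\<^sub>v x = (B *\<^sub>v u) @\<^sub>v (diag_block_mat Bs *\<^sub>v v)"
    unfolding uv(3) by (rule diag_block_mat_Cons_mult_vec[OF uv(1,2)])
  have dB: "dim_row B = n" and rows: "\<forall>B\<in>set Bs. dim_row B = n" using Cons.prems by auto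
  have dr: "dim_row (diag_block_mat Bs) = length Bs * n"
    using rows unfolding dim_diag_block_mat(1) by (induction Bs) auto
  show ?case
  proof (cases i)
    case 0
    then have "block n (diag_block_mat (B # Bs) *\<^sub>v x) i = B *\<^sub>v u"
      unfolding mult using dB by (intro eq_vecI) (auto simp: block_def)
    then show ?thesis using uv(1) 0 by auto
  next
    case (Suc k)
    then have k: "k < length Bs" using Cons.prems(3) by simp
    have "k * n + c < length Bs * n" if "c < n" for c by (rule block_index_less[OF k that])
    then have "block n (diag_block_mat (B # Bs) *\<^sub>v x) i = block n (diag_block_mat Bs *\<^sub>v v) k"
      unfolding mult using dB dr Suc by (intro eq_vecI) (auto simp: block_def)
    then show ?thesis using Cons.IH[OF rows uv(2) k] Suc by simp
  qed
qed simp

lemma append_vec_eq_zero_iff: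
  fixes u v :: "'a::zero vec"
  assumes "u \<in> carrier_vec k" "v \<in> carrier_vec l"
  shows "u @\<^sub>v v = 0\<^sub>v (k + l) \<longleftrightarrow> u = 0\<^sub>v k \<and> v = 0\<^sub>v l"
proof -
  have zero: "(0\<^sub>v (k + l) :: 'a vec) = 0\<^sub>v k @\<^sub>v 0\<^sub>v l" by (intro eq_vecI) auto
  have "u @\<^sub>v v = 0\<^sub>v k @\<^sub>v 0\<^sub>v l \<longleftrightarrow> u = 0\<^sub>v k \<and> v = 0\<^sub>v l"
    by (rule append_vec_eq[OF assms(1) zero_carrier_vec])
  with zero show ?thesis by (rule ssubst)
qed

lemma diag_block_mat_injective:
  fixes Bs :: "'a::semiring_1 mat list"
  assumes "\<And>B v. B \<in> set Bs \<Longrightarrow> v \<in> carrier_vec (dim_col B) \<Longrightarrow> B *\<^sub>v v = 0\<^sub>v (dim_row B) \<Longrightarrow> v = 0\<^sub>v (dim_col B)"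
    and "x \<in> carrier_vec (sum_list (map dim_col Bs))"
    and "diag_block_mat Bs *\<^sub>v x = 0\<^sub>v (sum_list (map dim_row Bs))"
  shows "x = 0\<^sub>v (sum_list (map dim_col Bs))"
  using assms
proof (induction Bs arbitrary: x)
  case (Cons B Bs)
  have "x \<in> carrier_vec (dim_col B + sum_list (map dim_col Bs))" using Cons.prems(2) by simp
  then obtain u v where uv: "u \<in> carrier_vec (dim_col B)" "v \<in> carrier_vec (sum_list (map dim_col Bs))" "x = u @\<^sub>v v"
    by (rule carrier_vec_add_split)
  have mult: "diag_block_mat (B # Bs) *\<^sub>v x = (B *\<^sub>v u) @\<^sub>v (diag_block_mat Bs *\<^sub>v v)"
    unfolding uv(3) by (rule diag_block_mat_Cons_mult_vec[OF uv(1,2)])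
  have app: "(B *\<^sub>v u) @\<^sub>v (diag_block_mat Bs *\<^sub>v v) = 0\<^sub>v (dim_row B + sum_list (map dim_row Bs))"
    using trans[OF mult[symmetric] Cons.prems(3)] by simp
  have "B *\<^sub>v u \<in> carrier_vec (dim_row B)"
    "diag_block_mat Bs *\<^sub>v v \<in> carrier_vec (sum_list (map dim_row Bs))"
    by (intro carrier_vecI; simp add: dim_diag_block_mat)+
  from app[unfolded append_vec_eq_zero_iff[OF this]]
  have zero: "B *\<^sub>v u = 0\<^sub>v (dim_row B)"
    "diag_block_mat Bs *\<^sub>v v = 0\<^sub>v (sum_list (map dim_row Bs))"
    by (rule conjunct1, rule conjunct2)
  have "u = 0\<^sub>v (dim_col B)"
    by (rule Cons.prems(1)[OF _ uv(1) zero(1)]) (rule list.set_intros(1))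
  moreover have "v = 0\<^sub>v (sum_list (map dim_col Bs))"
    by (rule Cons.IH[OF Cons.prems(1) uv(2) zero(2)]) (rule list.set_intros(2))
  ultimately show ?case
    unfolding uv(3) list.map sum_list.Cons append_vec_eq_zero_iff[OF uv(1,2)] by (rule conjI)
next
  case Nil
  from Nil(2) show ?case by (intro eq_vecI) simp_all
qed

lemma zero_if_blocks_zero:
  fixes y :: "'a::zero vec"
  assumes y: "y \<in> carrier_vec (N * n)" and zero: "\<And>i. i < N \<Longrightarrow> block n y i = 0\<^sub>v n"
  shows "y = 0\<^sub>v (N * n)"
proof (rule eq_vecI)
  fix a assume "a < dim_vec (0\<^sub>v (N * n) :: 'a vec)"
  then have a: "a < N * n" by simp
  then have "n > 0" by (cases n) auto
  then have i: "a div n < N" and c: "a mod n < n" using a by (auto simp: less_mult_imp_div_less)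
  have "block n y (a div n) $ (a mod n) = 0" using zero[OF i] c by simp
  then show "y $ a = 0\<^sub>v (N * n) $ a" using a c by (simp add: block_def)
qed (use y in simp)

section \<open>Observability\<close>

lemma orthonormal_cols_injective:
  assumes U: "orthonormal_cols U" and v: "v \<in> carrier_vec (dim_col U)" and z: "U *\<^sub>v v = 0\<^sub>v (dim_row U)"
  shows "v = 0\<^sub>v (dim_col U)"
proof -
  have "transpose_mat U * U = 1\<^sub>m (dim_col U)"
    using U[unfolded orthonormal_cols_def] by (intro eq_matI) simp_all
  then have "v = (transpose_mat U * U) *\<^sub>v v" by (simp only: one_mult_mat_vec[OF v])
  also have "\<dots> = transpose_mat U *\<^sub>v (U *\<^sub>v v)"
    using v by (intro assoc_mult_mat_vec) auto
  also have "\<dots> = 0\<^sub>v (dim_col U)" unfolding z by (intro eq_vecI) simp_all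
  finally show ?thesis .
qed

lemma stack_rows_Cons: "stack_rows n (X # Xs) = X @\<^sub>r stack_rows n Xs"
  by (simp add: stack_rows_def)

lemma stack_rows_carrier:
  assumes "\<And>X. X \<in> set Xs \<Longrightarrow> dim_col X = n"
  shows "stack_rows n Xs \<in> carrier_mat (sum_list (map dim_row Xs)) n"
  using assms
proof (induction Xs)
  case (Cons X Xs)
  then show ?case unfolding stack_rows_Cons list.map sum_list.Cons
    by (intro carrier_append_rows) auto
qed (simp add: stack_rows_def)

lemma stack_rows_mult_eq_zero_iff:
  fixes Xs :: "'a::comm_semiring_1 mat list"
  assumes "\<And>X. X \<in> set Xs \<Longrightarrow> dim_col X = n" "x \<in> carrier_vec n"
  shows "stack_rows n Xs *\<^sub>v x = 0\<^sub>v (sum_list (map dim_row Xs)) \<longleftrightarrow> (\<forall>X\<in>set Xs. X *\<^sub>v x = 0\<^sub>v (dim_row X))"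
  using assms
proof (induction Xs)
  case Nil
  then show ?case by (auto simp: stack_rows_def)
next
  case (Cons X Xs)
  have X: "X \<in> carrier_mat (dim_row X) n" using Cons.prems by auto
  have Xs: "stack_rows n Xs \<in> carrier_mat (sum_list (map dim_row Xs)) n"
    using Cons.prems by (intro stack_rows_carrier) auto
  have mult: "stack_rows n (X # Xs) *\<^sub>v x = (X *\<^sub>v x) @\<^sub>v (stack_rows n Xs *\<^sub>v x)"
    unfolding stack_rows_Cons by (rule mat_mult_append[OF X Xs Cons.prems(2)])
  have "stack_rows n (X # Xs) *\<^sub>v x = 0\<^sub>v (sum_list (map dim_row (X # Xs))) \<longleftrightarrow>
     X *\<^sub>v x = 0\<^sub>v (dim_row X) \<and> stack_rows n Xs *\<^sub>v x = 0\<^sub>v (sum_list (map dim_row Xs))"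
    unfolding mult list.map sum_list.Cons using X Xs Cons.prems(2)
    by (intro append_vec_eq_zero_iff mult_mat_vec_carrier)
  moreover have "stack_rows n Xs *\<^sub>v x = 0\<^sub>v (sum_list (map dim_row Xs)) \<longleftrightarrow>
      (\<forall>X\<in>set Xs. X *\<^sub>v x = 0\<^sub>v (dim_row X))"
    using Cons.prems by (intro Cons.IH) auto
  ultimately show ?case by (simp only: list.set ball_simps)
qed

lemma dim_col_observability_mat:
  assumes A: "A \<in> carrier_mat n n"
  shows "dim_col (observability_mat n C A) = n"
proof -
  have "\<And>X. X \<in> set (map (\<lambda>k. C * A ^\<^sub>m k) [0..<n]) \<Longrightarrow> dim_col X = n"
    using carrier_matD(2)[OF pow_carrier_mat[OF A]] by auto
  then show ?thesis
    unfolding observability_mat_def by (rule carrier_matD(2)[OF stack_rows_carrier])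
qed

lemma observability_mat_mult_eq_zero_iff:
  fixes C A :: "'a::comm_semiring_1 mat"
  assumes C: "C \<in> carrier_mat m n" and A: "A \<in> carrier_mat n n" and x: "x \<in> carrier_vec n"
  shows "observability_mat n C A *\<^sub>v x = 0\<^sub>v (dim_row (observability_mat n C A)) \<longleftrightarrow>
           (\<forall>k<n. C *\<^sub>v (A ^\<^sub>m k *\<^sub>v x) = 0\<^sub>v m)"
proof -
  let ?Xs = "map (\<lambda>k. C * A ^\<^sub>m k) [0..<n]"
  have cols: "\<And>X. X \<in> set ?Xs \<Longrightarrow> dim_col X = n" using C A by (auto simp: carrier_matD(2)[OF pow_carrier_mat[OF A]])
  have "dim_row (observability_mat n C A) = sum_list (map dim_row ?Xs)"
    using stack_rows_carrier[of ?Xs n, OF cols] by (simp add: observability_mat_def)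
  moreover have "C * A ^\<^sub>m k *\<^sub>v x = C *\<^sub>v (A ^\<^sub>m k *\<^sub>v x)" for k
    using C A x by (intro assoc_mult_mat_vec) auto
  ultimately show ?thesis
    using stack_rows_mult_eq_zero_iff[of ?Xs n x, OF cols x] C by (auto simp: observability_mat_def)
qed

text \<open>
  The rank is a dimension of a span of the \<^emph>\<open>set\<close> of columns. Full rank leaves no room for repeated
  columns, and distinct columns that span a space of full dimension are linearly independent.
\<close>

lemma full_column_rank_injective:
  fixes B :: "'a::field mat"
  assumes B: "B \<in> carrier_mat r n" and rank: "vec_space.rank r B = n"
    and x: "x \<in> carrier_vec n" "B *\<^sub>v x = 0\<^sub>v r"
  shows "x = 0\<^sub>v n"
proof -
  interpret vec_space "TYPE('a)" r .
  obtain S where S: "maximal S (\<lambda>T. T \<subseteq> set (cols B) \<and> lin_indpt T)"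
    using maximal_exists[of "(\<lambda>T. T \<subseteq> set (cols B) \<and> lin_indpt T)" "card (set (cols B))" "{}"]
    by (meson List.finite_set card_mono empty_iff empty_subsetI finite_lin_indpt2 rev_finite_subset)
  then have "card S \<le> card (set (cols B))" by (simp add: card_mono maximal_def)
  then have "length (cols B) \<le> card (set (cols B))"
    using rank rank_card_indpt[OF B S] B by simp
  then have dist: "distinct (cols B)" using card_distinct card_length le_antisym by blast
  show ?thesis
    using full_rank_lin_indpt[OF B rank dist] lin_depI[OF B x(1) _ x(2) dist] by blast
qed

text \<open>
  The rows of the observability matrix of the stacked outputs are those of the individual
  observability matrices in another order.
\<close>

lemma observable_unobservable_states_trivial:
  assumes A: "A \<in> carrier_mat n n" and C: "\<And>i. i < N \<Longrightarrow> C i \<in> carrier_mat (m i) n"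
    and obs: "observable n (stack_rows n (map C [0..<N])) A"
    and x: "x \<in> carrier_vec n"
    and z: "\<And>i. i < N \<Longrightarrow> observability_mat n (C i) A *\<^sub>v x = 0\<^sub>v (dim_row (observability_mat n (C i) A))"
  shows "x = 0\<^sub>v n"
proof -
  let ?C = "stack_rows n (map C [0..<N])"
  let ?O = "observability_mat n ?C A"
  have cols: "\<And>X. X \<in> set (map C [0..<N]) \<Longrightarrow> dim_col X = n"
    using carrier_matD(2)[OF C] by auto
  note Cc = stack_rows_carrier[of "map C [0..<N]" n, OF cols]
  have "?C *\<^sub>v (A ^\<^sub>m k *\<^sub>v x) = 0\<^sub>v (sum_list (map dim_row (map C [0..<N])))" if "k < n" for k
  proof (subst stack_rows_mult_eq_zero_iff[OF cols])
    show "A ^\<^sub>m k *\<^sub>v x \<in> carrier_vec n" using A x by (auto intro!: mult_mat_vec_carrier)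
    have "C i *\<^sub>v (A ^\<^sub>m k *\<^sub>v x) = 0\<^sub>v (m i)" if "i < N" for i
      using z[OF that] observability_mat_mult_eq_zero_iff[OF C[OF that] A x] \<open>k < n\<close> by blast
    then show "\<forall>X\<in>set (map C [0..<N]). X *\<^sub>v (A ^\<^sub>m k *\<^sub>v x) = 0\<^sub>v (dim_row X)"
      using carrier_matD(1)[OF C] by auto
  qed
  then have "?O *\<^sub>v x = 0\<^sub>v (dim_row ?O)"
    using observability_mat_mult_eq_zero_iff[OF Cc A x] by blast
  moreover have "?O \<in> carrier_mat (dim_row ?O) n"
    using dim_col_observability_mat[OF A] by blast
  ultimately show ?thesis
    using full_column_rank_injective[of ?O "dim_row ?O" n x] obs x unfolding observable_def by blast
qed

lemma kernel_basis_mult_in_kernel: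
  assumes U: "cols_orthonormal_basis_of_kernel B U" "dim_row U = dim_col B" and v: "v \<in> carrier_vec (dim_col U)"
  shows "B *\<^sub>v (U *\<^sub>v v) = 0\<^sub>v (dim_row B)"
proof -
  interpret kernel "dim_row B" "dim_col B" B by unfold_locales auto
  have "set (cols U) \<subseteq> mat_kernel B"
    using U(1) by (auto simp: cols_orthonormal_basis_of_kernel_def Ker.basis_def)
  then have ker: "B *\<^sub>v col U j = 0\<^sub>v (dim_row B)" if "j < dim_col U" for j
    using that unfolding mat_kernel_def cols_def by fastforce
  have "B * U = 0\<^sub>m (dim_row B) (dim_col U)"
  proof (rule eq_matI)
    fix i j assume "i < dim_row (0\<^sub>m (dim_row B) (dim_col U) :: real mat)"
      "j < dim_col (0\<^sub>m (dim_row B) (dim_col U) :: real mat)"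
    then have ij: "i < dim_row B" "j < dim_col U" by simp_all
    then have "(B * U) $$ (i, j) = (B *\<^sub>v col U j) $ i" by simp
    then show "(B * U) $$ (i, j) = 0\<^sub>m (dim_row B) (dim_col U) $$ (i, j)"
      using ij ker by simp
  qed simp_all
  moreover have "(B * U) *\<^sub>v v = B *\<^sub>v (U *\<^sub>v v)"
    using U(2) v by (intro assoc_mult_mat_vec) auto
  ultimately have "B *\<^sub>v (U *\<^sub>v v) = 0\<^sub>m (dim_row B) (dim_col U) *\<^sub>v v" by metis
  also have "\<dots> = 0\<^sub>v (dim_row B)" using v by (intro eq_vecI) simp_all
  finally show ?thesis .
qed

section \<open>Stability of the projected consensus dynamics\<close>

theorem lemma2:
  fixes n N n0 :: nat
    and m \<nu> :: "nat \<Rightarrow> nat"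
    and A Q Ubd :: "real mat"
    and C U :: "nat \<Rightarrow> real mat"
    and G :: "nat \<Rightarrow> nat pair_pre_digraph"
    and W :: "nat \<Rightarrow> real mat"
    and \<tau> :: real and ts :: "nat \<Rightarrow> real" and \<sigma> :: "real \<Rightarrow> nat"
  assumes A: "A \<in> carrier_mat n n"
    and C: "\<And>i. i < N \<Longrightarrow> C i \<in> carrier_mat (m i) n"
    and nu: "\<And>i. i < N \<Longrightarrow> \<nu> i = kernel_dim (observability_mat n (C i) A)"
    and U: "\<And>i. i < N \<Longrightarrow> U i \<in> carrier_mat n (\<nu> i)"
    and U_basis: "\<And>i. i < N \<Longrightarrow>
          cols_orthonormal_basis_of_kernel (observability_mat n (C i) A) (U i)"
    and Ubd: "Ubd = diag_block_mat (map U [0..<N])"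
    and Q: "symmetric_positive_definite (\<Sum>i<N. \<nu> i) Q"
    and signal: "switching_signal n0 \<tau> ts \<sigma>"
    and graphs: "\<And>p. p \<in> {1..n0} \<Longrightarrow> undirected_graph_on N (G p)"
    and weights: "\<And>p. p \<in> {1..n0} \<Longrightarrow> weighted_adjacency N (G p) (W p)"
    and obs: "observable n (stack_rows n (map C [0..<N])) A"
    and conn: "jointly_connected N \<tau> ts \<sigma> G"
  shows "exponentially_stable (\<Sum>i<N. \<nu> i)
           (\<lambda>t. - (Q * transpose_mat Ubd * kronecker (laplacian (W (\<sigma> t))) (1\<^sub>m n) * Ubd))
           (range ts)"
proof -
  define d where "d = (\<Sum>i<N. \<nu> i)"
  define K where "K p = kronecker (laplacian (W p)) (1\<^sub>m n)" for p
  define M where "M p = transpose_mat Ubd * K p * Ubd" for p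
  have rows: "sum_list (map dim_row (map U [0..<N])) = N * n"
    using carrier_matD(1)[OF U]
    by (simp add: comp_def interv_sum_list_conv_sum_set_nat atLeast0LessThan)
  have cols: "sum_list (map dim_col (map U [0..<N])) = d"
    using carrier_matD(2)[OF U]
    by (simp add: comp_def d_def interv_sum_list_conv_sum_set_nat atLeast0LessThan)
  have Ubd_carrier: "Ubd \<in> carrier_mat (N * n) d"
    unfolding Ubd by (rule carrier_matI) (simp_all only: dim_diag_block_mat rows cols)
  obtain P where P: "symmetric_positive_definite d P" "P * Q = 1\<^sub>m d"
    using spd_inverse Q unfolding d_def by blast
  have Qc: "Q \<in> carrier_mat d d" using Q by (simp add: symmetric_positive_definite_def d_def)
  have K_psd: "symmetric_psd (N * n) (K p)" if "p \<in> {1..n0}" for p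
    unfolding K_def by (rule psd_kronecker_laplacian[OF weights[OF that]])
  interpret switched_gradient_flow \<tau> ts d n0 Q P M \<sigma>
  proof
    show "\<And>p. p \<in> {1..n0} \<Longrightarrow> symmetric_psd d (M p)"
      unfolding M_def by (rule psd_gram[OF K_psd Ubd_carrier])
  qed (use signal Qc P in \<open>auto simp: switching_signal_def\<close>)
  obtain Tc J where Tc: "Tc > 0" and J: "strict_mono J" "ts (J 0) = 0"
    and window: "\<And>k. ts (J (Suc k)) - ts (J k) \<le> Tc"
    and union: "\<And>k. Digraph_Component.connected (with_proj
             \<lparr>pverts = {..<N},
              parcs = (\<Union>j \<in> {j. ts j \<in> {ts (J k)..<ts (J (Suc k))}}. parcs (G (\<sigma> (ts j))))\<rparr>)"
    using conn unfolding jointly_connected_def by blast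
  have "x = 0\<^sub>v d" if x: "x \<in> carrier_vec d"
    and zero: "\<And>j. j \<in> {J k..<J (Suc k)} \<Longrightarrow> x \<bullet> (M (\<sigma> (ts j)) *\<^sub>v x) = 0" for k x
  proof -
    define y where "y = Ubd *\<^sub>v x"
    have y: "y \<in> carrier_vec (N * n)" using Ubd_carrier x by (simp add: y_def)
    have edge: "block n y a = block n y b"
      if "(a, b) \<in> (\<Union>j \<in> {j. ts j \<in> {ts (J k)..<ts (J (Suc k))}}. parcs (G (\<sigma> (ts j))))" for a b
    proof -
      from that obtain j where j: "j \<in> {J k..<J (Suc k)}" and ab: "(a, b) \<in> parcs (G (\<sigma> (ts j)))"
        using ts_le_iff ts_less_iff by auto
      define p where "p = \<sigma> (ts j)"
      have p: "p \<in> {1..n0}" unfolding p_def by (rule \<sigma>_range[OF ts_nonneg])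
      have "pair_wf_digraph (G p)" and V: "pverts (G p) = {..<N}"
        using graphs[OF p]
        by (simp_all add: undirected_graph_on_def pair_sym_digraph_def)
      then have N: "a < N" "b < N"
        using ab pair_wf_digraph.in_arcsD1 pair_wf_digraph.in_arcsD2 unfolding p_def by fastforce+
      note Wp = weights[OF p, unfolded weighted_adjacency_def]
      show ?thesis
      proof (cases "a = b")
        case False
        have "y \<bullet> (K p *\<^sub>v y) = 0"
          using zero[OF j] unfolding y_def M_def p_def[symmetric] gram_form[OF Ubd_carrier psdD(1)[OF K_psd[OF p]] x] .
        \<comment> \<open>Entry \<open>(b, a)\<close> of the adjacency matrix is the weight of the arc \<open>(a, b)\<close>.\<close>
        moreover have "W p $$ (b, a) > 0" using Wp N ab False by (simp add: p_def)
        ultimately have "block n y b = block n y a"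
          using Wp N y weighted_adjacency_nonneg[OF weights[OF p]] unfolding K_def
          by (intro kronecker_laplacian_form_zero_imp_blocks_eq[of "W p" N]) auto
        then show ?thesis ..
      qed simp
    qed
    have "block n y i = 0\<^sub>v n" if i: "i < N" for i
    proof (rule observable_unobservable_states_trivial[OF A C obs])
      show "block n y i \<in> carrier_vec n" by (simp add: block_def)
      fix l assume l: "l < N"
      let ?O = "observability_mat n (C l) A"
      have eq: "block n y i = block n y l"
        using connected_imp_constant[OF union edge] i l by simp
      have "\<exists>v\<in>carrier_vec (dim_col (map U [0..<N] ! l)). block n y l = map U [0..<N] ! l *\<^sub>v v"
        unfolding y_def Ubd using x l carrier_matD(1)[OF U]
        by (intro block_diag_block_mat_mult) (auto simp only: cols, auto)
      then obtain v where v: "v \<in> carrier_vec (dim_col (U l))" "block n y l = U l *\<^sub>v v"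
        using l by auto
      have "?O *\<^sub>v (U l *\<^sub>v v) = 0\<^sub>v (dim_row ?O)"
        using U[OF l] v(1) dim_col_observability_mat[OF A]
        by (intro kernel_basis_mult_in_kernel[OF U_basis[OF l]]) auto
      then show "?O *\<^sub>v block n y i = 0\<^sub>v (dim_row ?O)" unfolding eq v(2) .
    qed
    then have "y = 0\<^sub>v (N * n)" by (rule zero_if_blocks_zero[OF y])
    then have "diag_block_mat (map U [0..<N]) *\<^sub>v x = 0\<^sub>v (sum_list (map dim_row (map U [0..<N])))"
      unfolding rows by (simp add: y_def Ubd)
    then have "x = 0\<^sub>v (sum_list (map dim_col (map U [0..<N])))"
    proof (rule diag_block_mat_injective[rotated 2])
      show "x \<in> carrier_vec (sum_list (map dim_col (map U [0..<N])))" using x unfolding cols .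
      fix B v assume B: "B \<in> set (map U [0..<N])"
        and v: "v \<in> carrier_vec (dim_col B)" "B *\<^sub>v v = 0\<^sub>v (dim_row B)"
      from B obtain i where "i < N" "B = U i" by auto
      then have "orthonormal_cols B"
        using U_basis by (auto simp: cols_orthonormal_basis_of_kernel_def)
      then show "v = 0\<^sub>v (dim_col B)" using v by (rule orthonormal_cols_injective)
    qed
    then show ?thesis unfolding cols .
  qed
  then have "exponentially_stable d (\<lambda>t. - (Q * M (\<sigma> t))) (range ts)"
    by (rule exponentially_stable_if_jointly_definite[OF Tc J window])
  moreover have "exponentially_stable d (\<lambda>t. - (Q * M (\<sigma> t))) (range ts) \<longleftrightarrow>
      exponentially_stable d (\<lambda>t. - (Q * transpose_mat Ubd * K (\<sigma> t) * Ubd)) (range ts)"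
  proof (rule exponentially_stable_cong)
    fix t :: real assume "0 \<le> t"
    note Kc = psdD(1)[OF K_psd[OF \<sigma>_range[OF this]]]
    have Ut: "transpose_mat Ubd \<in> carrier_mat d (N * n)" using Ubd_carrier by simp
    have QUt: "Q * transpose_mat Ubd \<in> carrier_mat d (N * n)" using Qc Ut by simp
    have "Q * M (\<sigma> t) = Q * (transpose_mat Ubd * K (\<sigma> t)) * Ubd"
      unfolding M_def using Qc Ut Kc Ubd_carrier
      by (intro assoc_mult_mat[symmetric, of _ d d _ "N * n" _ d]) simp_all
    also have "Q * (transpose_mat Ubd * K (\<sigma> t)) = Q * transpose_mat Ubd * K (\<sigma> t)"
      by (rule assoc_mult_mat[OF Qc Ut Kc, symmetric])
    finally show "- (Q * M (\<sigma> t)) = - (Q * transpose_mat Ubd * K (\<sigma> t) * Ubd)" by simp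
  qed
  ultimately show ?thesis unfolding d_def K_def by blast
qed

end
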